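(* The category of d-Boolean algebras and d-lattice homomorphisms is equivalent to the category of distributive lattices and lattice homomorphisms.
   Context: Distributive lattices are bounded (with top $1$ and bottom $0$), and lattice homomorphisms preserve $0$ and $1$. Let $(L,\sqsubseteq)$ be a distributive lattice with meet $\sqcap$ and join $\sqcup$, and let $\mathit{tt},\mathit{ff}\in L$ be complementary: $\mathit{tt}\sqcup\mathit{ff}=1$, $\mathit{tt}\sqcap\mathit{ff}=0$. It is always assumed that the complementary pair $\{\mathit{tt},\mathit{ff}\}$ is different from $\{1,0\}$. Put $L_+=\{a\in L:a\sqsubseteq\mathit{tt}\}$ and $L_-=\{b\in L:b\sqsubseteq\mathit{ff}\}$. Each $x\in L$ is uniquely $a\sqcup b$ with $a\in L_+$, $b\in L_-$. The information order is $\sqsubseteq$. The logic order $\le$ on $L$ is: $x\le y$ iff $x\sqcap\mathit{tt}\sqsubseteq y\sqcap\mathit{tt}$ and $x\sqcap\mathit{ff}\sqsupseteq y\sqcap\mathit{ff}$. It is a lattice order with $x\wedge y=(x\sqcap\mathit{ff})\sqcup(y\sqcap\mathit{ff})\sqcup(x\sqcap y)$ and $x\vee y=(x\sqcap\mathit{tt})\sqcup(y\sqcap\mathit{tt})\sqcup(x\sqcap y)$. A d-lattice is a structure $(L;\mathit{tt},\mathit{ff};\mathbf{con},\mathbf{tot})$, where $(L,\sqsubseteq)$ is a distributive lattice, $\mathit{tt},\mathit{ff}\in L$ are complementary elements with $\{\mathit{tt},\mathit{ff}\}\neq\{1,0\}$, and $\mathbf{con},\mathbf{tot}\subseteq L$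 are such that: $\mathit{tt},\mathit{ff}\in\mathbf{con}$ and $\mathit{tt},\mathit{ff}\in\mathbf{tot}$; $\mathbf{con}$ is a lower set and $\mathbf{tot}$ is an upper set for $\sqsubseteq$; $\mathbf{con}$ and $\mathbf{tot}$ are sublattices of $L$ for the logic order, i.e. closed under $\wedge$ and $\vee$; and if $\alpha\in\mathbf{con}$, $\beta\in\mathbf{tot}$ and ($\alpha\sqcap\mathit{tt}=\beta\sqcap\mathit{tt}$ or $\alpha\sqcap\mathit{ff}=\beta\sqcap\mathit{ff}$), then $\alpha\sqsubseteq\beta$. A d-lattice homomorphism from $(L;\mathit{tt},\mathit{ff};\mathbf{con},\mathbf{tot})$ to $(L';\mathit{tt}',\mathit{ff}';\mathbf{con}',\mathbf{tot}')$ is a lattice homomorphism $f\colon L\to L'$ (for $\sqsubseteq$) with $f(\mathit{tt})=\mathit{tt}'$, $f(\mathit{ff})=\mathit{ff}'$, $f(\mathbf{con})\subseteq\mathbf{con}'$, $f(\mathbf{tot})\subseteq\mathbf{tot}'$. A d-Boolean algebra is a d-lattice in which every $a\in L_+$ has some $a^\dag\in L_-$ with $a\sqcup a^\dag\in\mathbf{con}\cap\mathbf{tot}$, and every $b\in L_-$ has some $b^\dag\in L_+$ with $b^\dag\sqcup b\in\mathbf{con}\cap\mathbf{tot}$.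
   Formalization: The one-element distributive lattice is excluded: it would be terminal, while {tt,ff}≠{1,0} leaves d-Boolean algebras without a terminal object. All lattices and d-Boolean algebras have carriers inside one arbitrary infinite universe set. *)

theory Defs
  imports "HOL-Algebra.Lattice" "HOL-Library.FuncSet"
begin

section \<open>Categories, functors and equivalence\<close>

text \<open>
  A category is given by a set of objects and a family of hom-sets; hom-sets need not be
  disjoint, so composition and the arrow part of a functor take the objects involved as
  arguments. The term \<open>Comp C X Y Z g f\<close> is \<open>g\<close> after \<open>f\<close> for \<open>f : X \<rightarrow> Y\<close> and \<open>g : Y \<rightarrow> Z\<close>.
\<close>

record ('o, 'm) cat =
  Obj :: "'o set"
  Hom :: "'o \<Rightarrow> 'o \<Rightarrow> 'm set"
  Ident :: "'o \<Rightarrow> 'm"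
  Comp :: "'o \<Rightarrow> 'o \<Rightarrow> 'o \<Rightarrow> 'm \<Rightarrow> 'm \<Rightarrow> 'm"

locale category =
  fixes C :: "('o, 'm) cat"
  assumes ident_closed: "X \<in> Obj C \<Longrightarrow> Ident C X \<in> Hom C X X"
    and comp_closed:
      "\<lbrakk>X \<in> Obj C; Y \<in> Obj C; Z \<in> Obj C; f \<in> Hom C X Y; g \<in> Hom C Y Z\<rbrakk>
        \<Longrightarrow> Comp C X Y Z g f \<in> Hom C X Z"
    and comp_ident_right:
      "\<lbrakk>X \<in> Obj C; Y \<in> Obj C; f \<in> Hom C X Y\<rbrakk> \<Longrightarrow> Comp C X X Y f (Ident C X) = f"
    and comp_ident_left:
      "\<lbrakk>X \<in> Obj C; Y \<in> Obj C; f \<in> Hom C X Y\<rbrakk> \<Longrightarrow> Comp C X Y Y (Ident C Y) f = f"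
    and comp_assoc:
      "\<lbrakk>W \<in> Obj C; X \<in> Obj C; Y \<in> Obj C; Z \<in> Obj C;
        f \<in> Hom C W X; g \<in> Hom C X Y; h \<in> Hom C Y Z\<rbrakk>
        \<Longrightarrow> Comp C W Y Z h (Comp C W X Y g f) = Comp C W X Z (Comp C X Y Z h g) f"

definition cat_iso :: "('o, 'm) cat \<Rightarrow> 'o \<Rightarrow> 'o \<Rightarrow> 'm set" where
  "cat_iso C X Y = {f \<in> Hom C X Y. \<exists>g \<in> Hom C Y X.
     Comp C X Y X g f = Ident C X \<and> Comp C Y X Y f g = Ident C Y}"

record ('o, 'm, 'p, 'n) ftor =
  OMap :: "'o \<Rightarrow> 'p"
  AMap :: "'o \<Rightarrow> 'o \<Rightarrow> 'm \<Rightarrow> 'n"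

locale cat_functor = dom: category C + cod: category D
  for C :: "('o, 'm) cat" and D :: "('p, 'n) cat" +
  fixes F :: "('o, 'm, 'p, 'n) ftor"
  assumes omap_closed: "X \<in> Obj C \<Longrightarrow> OMap F X \<in> Obj D"
    and amap_closed:
      "\<lbrakk>X \<in> Obj C; Y \<in> Obj C; f \<in> Hom C X Y\<rbrakk>
        \<Longrightarrow> AMap F X Y f \<in> Hom D (OMap F X) (OMap F Y)"
    and amap_ident: "X \<in> Obj C \<Longrightarrow> AMap F X X (Ident C X) = Ident D (OMap F X)"
    and amap_comp:
      "\<lbrakk>X \<in> Obj C; Y \<in> Obj C; Z \<in> Obj C; f \<in> Hom C X Y; g \<in> Hom C Y Z\<rbrakk>
        \<Longrightarrow> AMap F X Z (Comp C X Y Z g f) =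
            Comp D (OMap F X) (OMap F Y) (OMap F Z) (AMap F Y Z g) (AMap F X Y f)"

definition id_ftor :: "('o, 'm, 'o, 'm) ftor" where
  "id_ftor = \<lparr>OMap = (\<lambda>X. X), AMap = (\<lambda>X Y f. f)\<rparr>"

definition comp_ftor ::
  "('p, 'n, 'q, 'k) ftor \<Rightarrow> ('o, 'm, 'p, 'n) ftor \<Rightarrow> ('o, 'm, 'q, 'k) ftor" where
  "comp_ftor G F =
     \<lparr>OMap = (\<lambda>X. OMap G (OMap F X)),
      AMap = (\<lambda>X Y f. AMap G (OMap F X) (OMap F Y) (AMap F X Y f))\<rparr>"

definition naturally_isomorphic ::
  "('o, 'm) cat \<Rightarrow> ('p, 'n) cat \<Rightarrow> ('o, 'm, 'p, 'n) ftor \<Rightarrow> ('o, 'm, 'p, 'n) ftor \<Rightarrow> bool" where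
  "naturally_isomorphic C D F G \<longleftrightarrow>
     cat_functor C D F \<and> cat_functor C D G \<and>
     (\<exists>\<tau>. (\<forall>X \<in> Obj C. \<tau> X \<in> cat_iso D (OMap F X) (OMap G X)) \<and>
          (\<forall>X \<in> Obj C. \<forall>Y \<in> Obj C. \<forall>f \<in> Hom C X Y.
             Comp D (OMap F X) (OMap F Y) (OMap G Y) (\<tau> Y) (AMap F X Y f) =
             Comp D (OMap F X) (OMap G X) (OMap G Y) (AMap G X Y f) (\<tau> X)))"

definition equivalent_categories :: "('o, 'm) cat \<Rightarrow> ('p, 'n) cat \<Rightarrow> bool" where
  "equivalent_categories C D \<longleftrightarrow>
     category C \<and> category D \<and>
     (\<exists>F G. cat_functor C D F \<and> cat_functor D C G \<and>
            naturally_isomorphic C C (comp_ftor G F) id_ftor \<and>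
            naturally_isomorphic D D (comp_ftor F G) id_ftor)"

text \<open>
  Arrows of a category of structured sets are required to be undefined outside the carrier of
  their domain, so that equality of arrows is pointwise equality on the carrier.
\<close>

definition concrete_category ::
  "('a, 'b) partial_object_scheme set \<Rightarrow>
   (('a, 'b) partial_object_scheme \<Rightarrow> ('a, 'b) partial_object_scheme \<Rightarrow> ('a \<Rightarrow> 'a) set) \<Rightarrow>
   (('a, 'b) partial_object_scheme, 'a \<Rightarrow> 'a) cat" where
  "concrete_category \<O> \<H> =
     \<lparr>Obj = \<O>, Hom = \<H>,
      Ident = (\<lambda>A. \<lambda>x \<in> carrier A. x),
      Comp = (\<lambda>A B C g f. compose (carrier A) g f)\<rparr>"


section \<open>Distributive lattices\<close>

locale distributive_lattice = bounded_lattice L for L (structure) +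
  assumes meet_join_distrib:
    "\<lbrakk>x \<in> carrier L; y \<in> carrier L; z \<in> carrier L\<rbrakk>
      \<Longrightarrow> x \<sqinter> (y \<squnion> z) = (x \<sqinter> y) \<squnion> (x \<sqinter> z)"

definition lattice_hom ::
  "('a, 'c) gorder_scheme \<Rightarrow> ('b, 'd) gorder_scheme \<Rightarrow> ('a \<Rightarrow> 'b) set" where
  "lattice_hom A B =
     {f \<in> carrier A \<rightarrow>\<^sub>E carrier B.
        join_pres A B f \<and> meet_pres A B f \<and> f \<bottom>\<^bsub>A\<^esub> = \<bottom>\<^bsub>B\<^esub> \<and> f \<top>\<^bsub>A\<^esub> = \<top>\<^bsub>B\<^esub>}"

text \<open>
  The degenerate one-element lattice is not an object. It cannot be admitted: the condition
  \<open>{tt, ff} \<noteq> {1, 0}\<close> forces \<open>0 \<noteq> 1\<close> in every d-lattice (and \<open>L\<^sub>+ \<noteq> {0}\<close>), whereas the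
  one-element lattice would be a terminal object.
\<close>

definition distributive_lattice_category :: "('a gorder, 'a \<Rightarrow> 'a) cat" where
  "distributive_lattice_category =
     concrete_category {L. distributive_lattice L \<and> \<bottom>\<^bsub>L\<^esub> \<noteq> \<top>\<^bsub>L\<^esub>} lattice_hom"


section \<open>d-lattices and d-Boolean algebras\<close>

record 'a d_struct = "'a gorder" +
  tt :: 'a
  ff :: 'a
  con :: "'a set"
  tot :: "'a set"

definition pos_part :: "('a, 'b) d_struct_scheme \<Rightarrow> 'a set" where
  "pos_part L = {a \<in> carrier L. a \<sqsubseteq>\<^bsub>L\<^esub> tt L}"

definition neg_part :: "('a, 'b) d_struct_scheme \<Rightarrow> 'a set" where
  "neg_part L = {b \<in> carrier L. b \<sqsubseteq>\<^bsub>L\<^esub> ff L}"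

text \<open>
  Meet and join of the logic order, in which \<open>x\<close> is below \<open>y\<close> iff
  \<open>x \<sqinter> tt \<sqsubseteq> y \<sqinter> tt\<close> and \<open>y \<sqinter> ff \<sqsubseteq> x \<sqinter> ff\<close>.
\<close>

definition logic_meet :: "('a, 'b) d_struct_scheme \<Rightarrow> 'a \<Rightarrow> 'a \<Rightarrow> 'a" where
  "logic_meet L x y = (x \<sqinter>\<^bsub>L\<^esub> ff L) \<squnion>\<^bsub>L\<^esub> (y \<sqinter>\<^bsub>L\<^esub> ff L) \<squnion>\<^bsub>L\<^esub> (x \<sqinter>\<^bsub>L\<^esub> y)"

definition logic_join :: "('a, 'b) d_struct_scheme \<Rightarrow> 'a \<Rightarrow> 'a \<Rightarrow> 'a" where
  "logic_join L x y = (x \<sqinter>\<^bsub>L\<^esub> tt L) \<squnion>\<^bsub>L\<^esub> (y \<sqinter>\<^bsub>L\<^esub> tt L) \<squnion>\<^bsub>L\<^esub> (x \<sqinter>\<^bsub>L\<^esub> y)"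

locale d_lattice = distributive_lattice L for L :: "('a, 'b) d_struct_scheme" (structure) +
  assumes tt_closed: "tt L \<in> carrier L"
    and ff_closed: "ff L \<in> carrier L"
    and tt_join_ff: "tt L \<squnion> ff L = \<top>"
    and tt_meet_ff: "tt L \<sqinter> ff L = \<bottom>"
    and tt_ff_proper: "{tt L, ff L} \<noteq> {\<top>, \<bottom>}"
    and con_subset: "con L \<subseteq> carrier L"
    and tot_subset: "tot L \<subseteq> carrier L"
    and tt_con: "tt L \<in> con L"
    and ff_con: "ff L \<in> con L"
    and tt_tot: "tt L \<in> tot L"
    and ff_tot: "ff L \<in> tot L"
    and con_lower: "\<lbrakk>x \<in> con L; y \<in> carrier L; y \<sqsubseteq> x\<rbrakk> \<Longrightarrow> y \<in> con L"
    and tot_upper: "\<lbrakk>x \<in> tot L; y \<in> carrier L; x \<sqsubseteq> y\<rbrakk> \<Longrightarrow> y \<in> tot L"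
    and con_logic_meet: "\<lbrakk>x \<in> con L; y \<in> con L\<rbrakk> \<Longrightarrow> logic_meet L x y \<in> con L"
    and con_logic_join: "\<lbrakk>x \<in> con L; y \<in> con L\<rbrakk> \<Longrightarrow> logic_join L x y \<in> con L"
    and tot_logic_meet: "\<lbrakk>x \<in> tot L; y \<in> tot L\<rbrakk> \<Longrightarrow> logic_meet L x y \<in> tot L"
    and tot_logic_join: "\<lbrakk>x \<in> tot L; y \<in> tot L\<rbrakk> \<Longrightarrow> logic_join L x y \<in> tot L"
    and con_tot:
      "\<lbrakk>\<alpha> \<in> con L; \<beta> \<in> tot L; \<alpha> \<sqinter> tt L = \<beta> \<sqinter> tt L \<or> \<alpha> \<sqinter> ff L = \<beta> \<sqinter> ff L\<rbrakk> \<Longrightarrow> \<alpha> \<sqsubseteq> \<beta>"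

lemma (in d_lattice) bottom_neq_top: "\<bottom> \<noteq> \<top>"
proof
  assume eq: "\<bottom> = \<top>"
  have "x = \<top>" if x: "x \<in> carrier L" for x
    using x eq bottom_lower[OF x] top_higher[OF x] top_closed by (metis le_antisym)
  then have "tt L = \<top>" "ff L = \<top>"
    using tt_closed ff_closed by blast+
  then show False
    using tt_ff_proper eq by simp
qed

definition d_lattice_hom ::
  "('a, 'c) d_struct_scheme \<Rightarrow> ('b, 'd) d_struct_scheme \<Rightarrow> ('a \<Rightarrow> 'b) set" where
  "d_lattice_hom A B =
     {f \<in> lattice_hom A B.
        f (tt A) = tt B \<and> f (ff A) = ff B \<and> f ` con A \<subseteq> con B \<and> f ` tot A \<subseteq> tot B}"

locale d_boolean_algebra = d_lattice +
  assumes pos_complement: "a \<in> pos_part L \<Longrightarrow> \<exists>a' \<in> neg_part L. a \<squnion> a' \<in> con L \<inter> tot L"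
    and neg_complement: "b \<in> neg_part L \<Longrightarrow> \<exists>b' \<in> pos_part L. b' \<squnion> b \<in> con L \<inter> tot L"

definition d_boolean_algebra_category :: "('a d_struct, 'a \<Rightarrow> 'a) cat" where
  "d_boolean_algebra_category = concrete_category {L. d_boolean_algebra L} d_lattice_hom"

end

theory Submission
  imports Defs
begin

text \<open>
  In a d-Boolean algebra \<open>L\<close> the complement \<open>\<dagger>\<close> is an order-reversing bijection from \<open>L\<^sub>-\<close> to \<open>L\<^sub>+\<close>,
  so \<open>x \<mapsto> (x \<sqinter> tt, (x \<sqinter> ff)\<^sup>\<dagger>)\<close> identifies \<open>L\<close> with \<open>L\<^sub>+ \<times> L\<^sub>+\<^sup>o\<^sup>p\<close>. Writing \<open>(p, q)\<close> for these
  coordinates, \<open>con\<close> becomes \<open>p \<sqsubseteq> q\<close> and \<open>tot\<close> becomes \<open>q \<sqsubseteq> p\<close>; the axiom linking \<open>con\<close> and \<open>tot\<close>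
  is exactly what makes these descriptions correct. Hence \<open>L\<close> and its homomorphisms are determined by
  the distributive lattice \<open>L\<^sub>+\<close>, and \<open>L \<mapsto> L\<^sub>+\<close> is fully faithful. Conversely every distributive
  lattice \<open>M\<close> with \<open>0 \<noteq> 1\<close> is \<open>L\<^sub>+\<close> for \<open>L = M \<times> M\<^sup>o\<^sup>p\<close>; an infinite type \<open>'a\<close> has room for this
  product because it is in bijection with \<open>'a \<times> 'a\<close>.
\<close>

section \<open>Fully faithful and essentially surjective functors\<close>

text \<open>Extensionality makes composition with a restricted identity return the arrow itself; the
  typing of arrows on carriers gives associativity.\<close>

lemma category_concrete_category:
  assumes "\<And>A B. A \<in> \<O> \<Longrightarrow> B \<in> \<O> \<Longrightarrow> \<H> A B \<subseteq> carrier A \<rightarrow>\<^sub>E carrier B"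
    and "\<And>A. A \<in> \<O> \<Longrightarrow> (\<lambda>x \<in> carrier A. x) \<in> \<H> A A"
    and "\<And>A B C f g. \<lbrakk>A \<in> \<O>; B \<in> \<O>; C \<in> \<O>; f \<in> \<H> A B; g \<in> \<H> B C\<rbrakk>
      \<Longrightarrow> compose (carrier A) g f \<in> \<H> A C"
  shows "category (concrete_category \<O> \<H>)"
proof
  have fn: "f \<in> carrier A \<rightarrow> carrier B" "f \<in> extensional (carrier A)"
    if "A \<in> \<O>" "B \<in> \<O>" "f \<in> \<H> A B" for A B f
    using assms(1)[OF that(1,2)] that(3) by (auto simp: PiE_def)
  show "Comp (concrete_category \<O> \<H>) X X Y f (Ident (concrete_category \<O> \<H>) X) = f"
    if "X \<in> Obj (concrete_category \<O> \<H>)" "Y \<in> Obj (concrete_category \<O> \<H>)"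
      "f \<in> Hom (concrete_category \<O> \<H>) X Y" for X Y f
    using that fn[of X Y f] by (auto simp: concrete_category_def intro: compose_Id)
  show "Comp (concrete_category \<O> \<H>) X Y Y (Ident (concrete_category \<O> \<H>) Y) f = f"
    if "X \<in> Obj (concrete_category \<O> \<H>)" "Y \<in> Obj (concrete_category \<O> \<H>)"
      "f \<in> Hom (concrete_category \<O> \<H>) X Y" for X Y f
    using that fn[of X Y f] by (auto simp: concrete_category_def intro: Id_compose)
  show "Comp (concrete_category \<O> \<H>) W Y Z h (Comp (concrete_category \<O> \<H>) W X Y g f) =
      Comp (concrete_category \<O> \<H>) W X Z (Comp (concrete_category \<O> \<H>) X Y Z h g) f"
    if "W \<in> Obj (concrete_category \<O> \<H>)" "X \<in> Obj (concrete_category \<O> \<H>)"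
      "Y \<in> Obj (concrete_category \<O> \<H>)" "Z \<in> Obj (concrete_category \<O> \<H>)"
      "f \<in> Hom (concrete_category \<O> \<H>) W X" "g \<in> Hom (concrete_category \<O> \<H>) X Y"
      "h \<in> Hom (concrete_category \<O> \<H>) Y Z" for W X Y Z f g h
    using that fn[of W X f] by (auto simp: concrete_category_def intro: compose_assoc)
qed (use assms in \<open>auto simp: concrete_category_def\<close>)

lemma cat_functor_comp_ftor:
  assumes "cat_functor C D F" and "cat_functor D E G"
  shows "cat_functor C E (comp_ftor G F)"
proof -
  interpret F: cat_functor C D F by fact
  interpret G: cat_functor D E G by fact
  show ?thesis
    by unfold_locales
      (simp_all add: comp_ftor_def F.omap_closed F.amap_closed F.amap_ident F.amap_comp
        G.omap_closed G.amap_closed G.amap_ident G.amap_comp)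
qed

lemma cat_functor_id_ftor: "category C \<Longrightarrow> cat_functor C C id_ftor"
  by (simp add: cat_functor_def cat_functor_axioms_def id_ftor_def)

text \<open>The weak inverse is built by choice: every object \<open>Y\<close> of \<open>D\<close>
  gets a representative \<open>R Y\<close> with an isomorphism \<open>\<epsilon> Y\<close> from its
  image to \<open>Y\<close>, and arrows are conjugated by these isomorphisms and lifted through
  \<open>F\<close>. Faithfulness reduces each equation in \<open>C\<close> to its image in
  \<open>D\<close>.\<close>

theorem equivalent_categories_if_fully_faithful:
  assumes F: "cat_functor C D F"
    and full: "\<And>X Y h. \<lbrakk>X \<in> Obj C; Y \<in> Obj C; h \<in> Hom D (OMap F X) (OMap F Y)\<rbrakk>
      \<Longrightarrow> \<exists>f \<in> Hom C X Y. AMap F X Y f = h"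
    and faithful: "\<And>X Y f g. \<lbrakk>X \<in> Obj C; Y \<in> Obj C; f \<in> Hom C X Y; g \<in> Hom C X Y;
      AMap F X Y f = AMap F X Y g\<rbrakk> \<Longrightarrow> f = g"
    and surj: "\<And>Y. Y \<in> Obj D \<Longrightarrow> \<exists>X \<in> Obj C. cat_iso D (OMap F X) Y \<noteq> {}"
  shows "equivalent_categories C D"
proof -
  interpret F: cat_functor C D F by fact
  have "\<forall>Y \<in> Obj D. \<exists>X e d. X \<in> Obj C \<and> e \<in> Hom D (OMap F X) Y \<and> d \<in> Hom D Y (OMap F X) \<and>
      Comp D (OMap F X) Y (OMap F X) d e = Ident D (OMap F X) \<and>
      Comp D Y (OMap F X) Y e d = Ident D Y"
    using surj unfolding cat_iso_def by blast
  then obtain R \<epsilon> \<delta> where R [simp]: "\<And>Y. Y \<in> Obj D \<Longrightarrow> R Y \<in> Obj C"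
    and \<epsilon> [simp]: "\<And>Y. Y \<in> Obj D \<Longrightarrow> \<epsilon> Y \<in> Hom D (OMap F (R Y)) Y"
    and \<delta> [simp]: "\<And>Y. Y \<in> Obj D \<Longrightarrow> \<delta> Y \<in> Hom D Y (OMap F (R Y))"
    and \<delta>\<epsilon> [simp]: "\<And>Y. Y \<in> Obj D \<Longrightarrow>
      Comp D (OMap F (R Y)) Y (OMap F (R Y)) (\<delta> Y) (\<epsilon> Y) = Ident D (OMap F (R Y))"
    and \<epsilon>\<delta> [simp]: "\<And>Y. Y \<in> Obj D \<Longrightarrow> Comp D Y (OMap F (R Y)) Y (\<epsilon> Y) (\<delta> Y) = Ident D Y"
    by metis
  \<comment> \<open>Reversed associativity nests all composites to the right, which gives a normal
    form for the equations below.\<close>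
  note [simp] = F.omap_closed F.amap_closed F.amap_ident F.amap_comp
    F.dom.ident_closed F.dom.comp_closed F.dom.comp_ident_left F.dom.comp_ident_right
    F.cod.ident_closed F.cod.comp_closed F.cod.comp_ident_left F.cod.comp_ident_right
    F.dom.comp_assoc[symmetric] F.cod.comp_assoc[symmetric]
  \<comment> \<open>In right-nested composites an inverse pair may be applied after a further arrow
    \<open>f\<close>, so the inverse laws are also needed in this absorbed form.\<close>
  have \<epsilon>\<delta>_cancel [simp]: "Comp D X (OMap F (R Y)) Y (\<epsilon> Y) (Comp D X Y (OMap F (R Y)) (\<delta> Y) f) = f"
    if "X \<in> Obj D" "Y \<in> Obj D" "f \<in> Hom D X Y" for X Y f
    using that F.cod.comp_assoc[of X Y "OMap F (R Y)" Y f "\<delta> Y" "\<epsilon> Y"]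
    by (simp del: F.cod.comp_assoc[symmetric])
  have \<delta>\<epsilon>_cancel [simp]: "Comp D X Y (OMap F (R Y)) (\<delta> Y) (Comp D X (OMap F (R Y)) Y (\<epsilon> Y) f) = f"
    if "X \<in> Obj D" "Y \<in> Obj D" "f \<in> Hom D X (OMap F (R Y))" for X Y f
    using that F.cod.comp_assoc[of X "OMap F (R Y)" Y "OMap F (R Y)" f "\<epsilon> Y" "\<delta> Y"]
    by (simp del: F.cod.comp_assoc[symmetric])
  \<comment> \<open>\<open>lift\<close> picks a preimage under \<open>F\<close>, which fullness
    supplies; \<open>conj\<close> moves an arrow from \<open>Y\<close> to \<open>Z\<close> onto the
    representatives along \<open>\<epsilon> Y\<close> and \<open>\<delta> Z\<close>.\<close>
  define lift where "lift X Y h = (SOME f. f \<in> Hom C X Y \<and> AMap F X Y f = h)" for X Y h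
  have lift [simp]: "lift X Y h \<in> Hom C X Y" "AMap F X Y (lift X Y h) = h"
    if "X \<in> Obj C" "Y \<in> Obj C" "h \<in> Hom D (OMap F X) (OMap F Y)" for X Y h
    using someI_ex[of "\<lambda>f. f \<in> Hom C X Y \<and> AMap F X Y f = h"] full[OF that]
    unfolding lift_def by blast+
  define conj where "conj Y Z h = Comp D (OMap F (R Y)) Z (OMap F (R Z)) (\<delta> Z)
      (Comp D (OMap F (R Y)) Y Z h (\<epsilon> Y))" for Y Z h
  have conj [simp]: "conj Y Z h \<in> Hom D (OMap F (R Y)) (OMap F (R Z))"
    if "Y \<in> Obj D" "Z \<in> Obj D" "h \<in> Hom D Y Z" for Y Z h
    using that by (simp add: conj_def)
  define G where "G = \<lparr>OMap = R, AMap = (\<lambda>Y Z h. lift (R Y) (R Z) (conj Y Z h))\<rparr>"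
  have G: "cat_functor D C G"
  proof
    show "AMap G X X (Ident D X) = Ident C (OMap G X)" if "X \<in> Obj D" for X
      by (rule faithful[of "R X" "R X"]) (use that in \<open>simp_all add: G_def conj_def\<close>)
    show "AMap G X Z (Comp D X Y Z g f) =
        Comp C (OMap G X) (OMap G Y) (OMap G Z) (AMap G Y Z g) (AMap G X Y f)"
      if "X \<in> Obj D" "Y \<in> Obj D" "Z \<in> Obj D" "f \<in> Hom D X Y" "g \<in> Hom D Y Z" for X Y Z f g
      by (rule faithful[of "R X" "R Z"]) (use that in \<open>simp_all add: G_def conj_def\<close>)
  qed (simp_all add: G_def)
  have GF: "naturally_isomorphic C C (comp_ftor G F) id_ftor"
    unfolding naturally_isomorphic_def
  proof (intro conjI exI ballI)
    fix X assume X: "X \<in> Obj C"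
    \<comment> \<open>\<open>F\<close> sends \<open>?\<tau> X\<close> to
      \<open>\<epsilon> (OMap F X)\<close>. The inverse of the latter lifts as well, and
      faithfulness makes the two lifts inverse to each other.\<close>
    let ?\<tau> = "\<lambda>X. lift (R (OMap F X)) X (\<epsilon> (OMap F X))"
    have "Comp C (R (OMap F X)) X (R (OMap F X)) (lift X (R (OMap F X)) (\<delta> (OMap F X))) (?\<tau> X)
        = Ident C (R (OMap F X))"
      by (rule faithful[of "R (OMap F X)" "R (OMap F X)"]) (use X in simp_all)
    moreover have "Comp C X (R (OMap F X)) X (?\<tau> X) (lift X (R (OMap F X)) (\<delta> (OMap F X)))
        = Ident C X"
      by (rule faithful[of X X]) (use X in simp_all)
    ultimately show "?\<tau> X \<in> cat_iso C (OMap (comp_ftor G F) X) (OMap id_ftor X)"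
      using X unfolding cat_iso_def
      by (auto simp: comp_ftor_def id_ftor_def G_def
          intro!: bexI[of _ "lift X (R (OMap F X)) (\<delta> (OMap F X))"])
    fix Y f assume Y: "Y \<in> Obj C" and f: "f \<in> Hom C X Y"
    show "Comp C (OMap (comp_ftor G F) X) (OMap (comp_ftor G F) Y) (OMap id_ftor Y)
          (?\<tau> Y) (AMap (comp_ftor G F) X Y f) =
        Comp C (OMap (comp_ftor G F) X) (OMap id_ftor X) (OMap id_ftor Y)
          (AMap id_ftor X Y f) (?\<tau> X)"
      by (rule faithful[of "R (OMap F X)" Y])
        (use X Y f in \<open>simp_all add: comp_ftor_def id_ftor_def G_def conj_def\<close>)
  qed (use F G in \<open>auto intro: cat_functor_comp_ftor cat_functor_id_ftor F.dom.category_axioms\<close>)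
  have FG: "naturally_isomorphic D D (comp_ftor F G) id_ftor"
    unfolding naturally_isomorphic_def
  proof (intro conjI exI ballI)
    fix Y assume Y: "Y \<in> Obj D"
    \<comment> \<open>Since \<open>F\<close> undoes \<open>lift\<close>, the composite acts on
      arrows as \<open>conj\<close>, and \<open>\<epsilon>\<close> is natural by cancelling
      \<open>\<epsilon> Z\<close> against \<open>\<delta> Z\<close>.\<close>
    show "\<epsilon> Y \<in> cat_iso D (OMap (comp_ftor F G) Y) (OMap id_ftor Y)"
      using Y unfolding cat_iso_def
      by (auto simp: comp_ftor_def id_ftor_def G_def intro!: bexI[of _ "\<delta> Y"])
    fix Z h assume "Z \<in> Obj D" "h \<in> Hom D Y Z"
    then show "Comp D (OMap (comp_ftor F G) Y) (OMap (comp_ftor F G) Z) (OMap id_ftor Z)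
          (\<epsilon> Z) (AMap (comp_ftor F G) Y Z h) =
        Comp D (OMap (comp_ftor F G) Y) (OMap id_ftor Y) (OMap id_ftor Z)
          (AMap id_ftor Y Z h) (\<epsilon> Y)"
      using Y by (simp add: comp_ftor_def id_ftor_def G_def conj_def)
  qed (use F G in \<open>auto intro: cat_functor_comp_ftor cat_functor_id_ftor F.cod.category_axioms\<close>)
  show ?thesis
    using F G GF FG F.dom.category_axioms F.cod.category_axioms
    unfolding equivalent_categories_def by blast
qed

section \<open>Distributive lattices and homomorphisms\<close>

lemma lattice_homD:
  assumes "f \<in> lattice_hom A B"
  shows "f \<in> carrier A \<rightarrow>\<^sub>E carrier B" "lattice A" "lattice B"
    and "x \<in> carrier A \<Longrightarrow> f x \<in> carrier B"
    and "\<lbrakk>x \<in> carrier A; y \<in> carrier A\<rbrakk> \<Longrightarrow> f (x \<squnion>\<^bsub>A\<^esub> y) = f x \<squnion>\<^bsub>B\<^esub> f y"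
    and "\<lbrakk>x \<in> carrier A; y \<in> carrier A\<rbrakk> \<Longrightarrow> f (x \<sqinter>\<^bsub>A\<^esub> y) = f x \<sqinter>\<^bsub>B\<^esub> f y"
    and "f \<bottom>\<^bsub>A\<^esub> = \<bottom>\<^bsub>B\<^esub>" "f \<top>\<^bsub>A\<^esub> = \<top>\<^bsub>B\<^esub>"
    and "\<lbrakk>x \<in> carrier A; y \<in> carrier A; x \<sqsubseteq>\<^bsub>A\<^esub> y\<rbrakk> \<Longrightarrow> f x \<sqsubseteq>\<^bsub>B\<^esub> f y"
  using assms join_pres_isotone[of f A B] use_iso2[of A B f]
  by (auto simp: lattice_hom_def join_pres_def meet_pres_def)

lemma (in bounded_lattice) lattice_hom_id: "(\<lambda>x \<in> carrier L. x) \<in> lattice_hom L L"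
  using lattice_axioms by (auto simp: lattice_hom_def join_pres_def meet_pres_def)

lemma (in bounded_lattice) lattice_hom_compose:
  assumes "f \<in> lattice_hom L B" "g \<in> lattice_hom B C"
  shows "compose (carrier L) g f \<in> lattice_hom L C"
  using assms lattice_homD[OF assms(1)] lattice_homD[OF assms(2)]
  by (auto simp: lattice_hom_def join_pres_def meet_pres_def compose_eq PiE_iff)

text \<open>\<open>join\<close> is a Hilbert choice among least upper bounds; antisymmetry pins it
  down.\<close>

lemma (in partial_order) join_equality: "least L s (Upper L {x, y}) \<Longrightarrow> x \<squnion> y = s"
  unfolding join_def Lattice.sup_def by (rule some_equality) (auto intro: least_unique)

lemma (in partial_order) meet_equality: "greatest L s (Lower L {x, y}) \<Longrightarrow> x \<sqinter> y = s"
  unfolding meet_def Lattice.inf_def by (rule some_equality) (auto intro: greatest_unique)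

context lattice
begin

lemma join_eqI:
  assumes "x \<in> carrier L" "y \<in> carrier L" "s \<in> carrier L" "x \<sqsubseteq> s" "y \<sqsubseteq> s"
    and "\<And>z. \<lbrakk>z \<in> carrier L; x \<sqsubseteq> z; y \<sqsubseteq> z\<rbrakk> \<Longrightarrow> s \<sqsubseteq> z"
  shows "x \<squnion> y = s"
  using assms by (intro join_equality least_UpperI) (auto simp: Upper_def)

lemma meet_eqI:
  assumes "x \<in> carrier L" "y \<in> carrier L" "s \<in> carrier L" "s \<sqsubseteq> x" "s \<sqsubseteq> y"
    and "\<And>z. \<lbrakk>z \<in> carrier L; z \<sqsubseteq> x; z \<sqsubseteq> y\<rbrakk> \<Longrightarrow> z \<sqsubseteq> s"
  shows "x \<sqinter> y = s"
  using assms by (intro meet_equality greatest_LowerI) (auto simp: Lower_def)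

lemma join_le_iff:
  "\<lbrakk>x \<in> carrier L; y \<in> carrier L; z \<in> carrier L\<rbrakk> \<Longrightarrow> x \<squnion> y \<sqsubseteq> z \<longleftrightarrow> x \<sqsubseteq> z \<and> y \<sqsubseteq> z"
  by (meson join_closed join_le join_left join_right le_trans)

lemma le_meet_iff:
  "\<lbrakk>x \<in> carrier L; y \<in> carrier L; z \<in> carrier L\<rbrakk> \<Longrightarrow> z \<sqsubseteq> x \<sqinter> y \<longleftrightarrow> z \<sqsubseteq> x \<and> z \<sqsubseteq> y"
  by (meson meet_closed meet_le meet_left meet_right le_trans)

end

text \<open>The record holds only an order, from which joins and meets are derived. Candidates with
  the right universal properties suffice, since they coincide with the derived operations.\<close>

lemma distributive_latticeI:
  fixes L (structure)
  assumes "partial_order L"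
    and j_closed: "\<And>x y. \<lbrakk>x \<in> carrier L; y \<in> carrier L\<rbrakk> \<Longrightarrow> j x y \<in> carrier L"
    and j_le: "\<And>x y z. \<lbrakk>x \<in> carrier L; y \<in> carrier L; z \<in> carrier L\<rbrakk>
      \<Longrightarrow> j x y \<sqsubseteq> z \<longleftrightarrow> x \<sqsubseteq> z \<and> y \<sqsubseteq> z"
    and m_closed: "\<And>x y. \<lbrakk>x \<in> carrier L; y \<in> carrier L\<rbrakk> \<Longrightarrow> m x y \<in> carrier L"
    and le_m: "\<And>x y z. \<lbrakk>x \<in> carrier L; y \<in> carrier L; z \<in> carrier L\<rbrakk>
      \<Longrightarrow> z \<sqsubseteq> m x y \<longleftrightarrow> z \<sqsubseteq> x \<and> z \<sqsubseteq> y"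
    and b: "b \<in> carrier L" "\<And>x. x \<in> carrier L \<Longrightarrow> b \<sqsubseteq> x"
    and t: "t \<in> carrier L" "\<And>x. x \<in> carrier L \<Longrightarrow> x \<sqsubseteq> t"
    and distrib: "\<And>x y z. \<lbrakk>x \<in> carrier L; y \<in> carrier L; z \<in> carrier L\<rbrakk>
      \<Longrightarrow> m x (j y z) = j (m x y) (m x z)"
  shows "distributive_lattice L"
proof -
  interpret partial_order L by fact
  \<comment> \<open>Putting \<open>j x y\<close> itself for \<open>z\<close> in \<open>j_le\<close>
    turns reflexivity into the upper bound property; \<open>m\<close> is treated dually.\<close>
  have j: "least L (j x y) (Upper L {x, y})" if "x \<in> carrier L" "y \<in> carrier L" for x y
    by (rule least_UpperI)
      (use that j_closed[OF that] j_le[OF that] j_le[OF that j_closed[OF that]] in \<open>auto simp: Upper_def\<close>)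
  have m: "greatest L (m x y) (Lower L {x, y})" if "x \<in> carrier L" "y \<in> carrier L" for x y
    by (rule greatest_LowerI)
      (use that m_closed[OF that] le_m[OF that] le_m[OF that m_closed[OF that]] in \<open>auto simp: Lower_def\<close>)
  have "least L b (carrier L)" "greatest L t (carrier L)"
    using b t by (simp_all add: least_def greatest_def)
  then interpret bounded_lattice L
    by unfold_locales (use j m in blast)+
  have jm: "x \<squnion> y = j x y" "x \<sqinter> y = m x y" if "x \<in> carrier L" "y \<in> carrier L" for x y
    using j[OF that] m[OF that] by (simp_all add: join_equality meet_equality)
  show ?thesis
  proof unfold_locales
    fix x y z assume xyz: "x \<in> carrier L" "y \<in> carrier L" "z \<in> carrier L"
    then have "x \<sqinter> (y \<squnion> z) = m x (y \<squnion> z)" "(x \<sqinter> y) \<squnion> (x \<sqinter> z) = j (x \<sqinter> y) (x \<sqinter> z)"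
      by (simp_all add: jm[OF _ join_closed] jm[OF meet_closed meet_closed])
    then show "x \<sqinter> (y \<squnion> z) = (x \<sqinter> y) \<squnion> (x \<sqinter> z)"
      using distrib[OF xyz] xyz by (simp add: jm)
  qed
qed

context bounded_lattice
begin

lemma le_bottom_iff: "x \<in> carrier L \<Longrightarrow> x \<sqsubseteq> \<bottom> \<longleftrightarrow> x = \<bottom>"
  by (metis bottom_closed bottom_lower le_antisym le_refl)

lemma top_le_iff: "x \<in> carrier L \<Longrightarrow> \<top> \<sqsubseteq> x \<longleftrightarrow> x = \<top>"
  by (metis top_closed top_higher le_antisym le_refl)

lemma bounds_simps [simp]:
  assumes "x \<in> carrier L"
  shows "x \<sqinter> \<bottom> = \<bottom>" "\<bottom> \<sqinter> x = \<bottom>" "x \<sqinter> \<top> = x" "\<top> \<sqinter> x = x"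
    and "x \<squnion> \<bottom> = x" "\<bottom> \<squnion> x = x" "x \<squnion> \<top> = \<top>" "\<top> \<squnion> x = \<top>"
  using assms bottom_meet bottom_join top_meet top_join
  by (simp_all add: eq_is_equal meet_comm[of L x] join_comm[of L x])

end

text \<open>Joins, meets and bounds are determined by the order, and surjectivity lets every
  competing bound in \<open>B\<close> be pulled back to \<open>A\<close>.\<close>

lemma order_iso_lattice_hom:
  assumes "bounded_lattice A" "bounded_lattice B" and f: "bij_betw f (carrier A) (carrier B)"
    and le: "\<And>x y. \<lbrakk>x \<in> carrier A; y \<in> carrier A\<rbrakk> \<Longrightarrow> f x \<sqsubseteq>\<^bsub>B\<^esub> f y \<longleftrightarrow> x \<sqsubseteq>\<^bsub>A\<^esub> y"
  shows "restrict f (carrier A) \<in> lattice_hom A B"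
proof -
  interpret A: bounded_lattice A by fact
  interpret B: bounded_lattice B by fact
  have f_closed [simp]: "f x \<in> carrier B" if "x \<in> carrier A" for x
    using f that by (auto simp: bij_betw_def)
  have surj: "\<exists>x \<in> carrier A. y = f x" if "y \<in> carrier B" for y
    using f that by (auto simp: bij_betw_def)
  have "f x \<squnion>\<^bsub>B\<^esub> f y = f (x \<squnion>\<^bsub>A\<^esub> y)" if "x \<in> carrier A" "y \<in> carrier A" for x y
  proof (rule B.join_eqI)
    fix z assume z: "z \<in> carrier B" "f x \<sqsubseteq>\<^bsub>B\<^esub> z" "f y \<sqsubseteq>\<^bsub>B\<^esub> z"
    then show "f (x \<squnion>\<^bsub>A\<^esub> y) \<sqsubseteq>\<^bsub>B\<^esub> z"
      using that surj[of z] by (auto simp: le A.join_le_iff)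
  qed (use that in \<open>simp_all add: le A.join_left A.join_right\<close>)
  moreover have "f x \<sqinter>\<^bsub>B\<^esub> f y = f (x \<sqinter>\<^bsub>A\<^esub> y)" if "x \<in> carrier A" "y \<in> carrier A" for x y
  proof (rule B.meet_eqI)
    fix z assume z: "z \<in> carrier B" "z \<sqsubseteq>\<^bsub>B\<^esub> f x" "z \<sqsubseteq>\<^bsub>B\<^esub> f y"
    then show "z \<sqsubseteq>\<^bsub>B\<^esub> f (x \<sqinter>\<^bsub>A\<^esub> y)"
      using that surj[of z] by (auto simp: le A.le_meet_iff)
  qed (use that in \<open>simp_all add: le A.meet_left A.meet_right\<close>)
  moreover have "f \<bottom>\<^bsub>A\<^esub> = \<bottom>\<^bsub>B\<^esub>"
    by (rule B.bottom_eq) (auto dest!: surj simp: le)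
  moreover have "f \<top>\<^bsub>A\<^esub> = \<top>\<^bsub>B\<^esub>"
    by (rule B.top_eq) (auto dest!: surj simp: le)
  ultimately show ?thesis
    using A.lattice_axioms B.lattice_axioms
    by (auto simp: lattice_hom_def join_pres_def meet_pres_def)
qed

section \<open>The positive part of a d-lattice\<close>

text \<open>In a d-lattice this is the interval from bottom to \<open>tt L\<close>, so its top is
  \<open>tt L\<close>. It is a bare \<open>gorder\<close>, as objects of the lattice category
  are.\<close>

definition pos_lattice :: "('a, 'b) d_struct_scheme \<Rightarrow> 'a gorder" where
  "pos_lattice L = \<lparr>carrier = pos_part L, eq = (=), le = le L\<rparr>"

lemma pos_lattice_simps [simp]:
  "carrier (pos_lattice L) = pos_part L" "eq (pos_lattice L) = (=)" "le (pos_lattice L) = le L"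
  by (simp_all add: pos_lattice_def)

context distributive_lattice
begin

lemma join_meet_distrib_right:
  assumes "x \<in> carrier L" "y \<in> carrier L" "z \<in> carrier L"
  shows "(x \<squnion> y) \<sqinter> z = (x \<sqinter> z) \<squnion> (y \<sqinter> z)"
  using meet_join_distrib[of z x y] assms by (simp add: meet_comm[of L z])

text \<open>Expanding the right-hand side by the assumed law gives \<open>y \<sqinter> z\<close> and
  terms absorbed by \<open>x\<close>. This dual law serves the second coordinate, which reverses the
  order.\<close>

lemma join_meet_distrib:
  assumes "x \<in> carrier L" "y \<in> carrier L" "z \<in> carrier L"
  shows "x \<squnion> (y \<sqinter> z) = (x \<squnion> y) \<sqinter> (x \<squnion> z)"
proof (rule join_eqI)
  fix u assume u: "u \<in> carrier L" "x \<sqsubseteq> u" "y \<sqinter> z \<sqsubseteq> u"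
  have "x \<sqinter> w \<sqsubseteq> u" if "w \<in> carrier L" for w
    using that u assms by (meson le_trans meet_closed meet_left)
  then show "(x \<squnion> y) \<sqinter> (x \<squnion> z) \<sqsubseteq> u"
    using u assms
    by (simp add: join_meet_distrib_right join_le_iff meet_join_distrib meet_comm[of L y x])
qed (use assms in \<open>auto simp: le_meet_iff join_left intro: le_trans join_right meet_left meet_right\<close>)

end

context d_lattice
begin

declare tt_closed [simp] ff_closed [simp] tt_join_ff [simp] tt_meet_ff [simp]

lemma ff_meet_tt [simp]: "ff L \<sqinter> tt L = \<bottom>"
  using tt_meet_ff meet_comm by metis

lemma pos_part_iff: "x \<in> pos_part L \<longleftrightarrow> x \<in> carrier L \<and> x \<sqinter> tt L = x"
  using le_iff_join[of x "tt L"] by (auto simp: pos_part_def)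

lemma neg_part_iff: "x \<in> neg_part L \<longleftrightarrow> x \<in> carrier L \<and> x \<sqinter> ff L = x"
  using le_iff_join[of x "ff L"] by (auto simp: neg_part_def)

lemma meet_tt_pos_part [simp]: "x \<in> carrier L \<Longrightarrow> x \<sqinter> tt L \<in> pos_part L"
  by (simp add: pos_part_def meet_right)

lemma meet_ff_neg_part [simp]: "x \<in> carrier L \<Longrightarrow> x \<sqinter> ff L \<in> neg_part L"
  by (simp add: neg_part_def meet_right)

lemma pos_part_closed: "x \<in> pos_part L \<Longrightarrow> x \<in> carrier L"
  by (simp add: pos_part_def)

lemma neg_part_closed: "x \<in> neg_part L \<Longrightarrow> x \<in> carrier L"
  by (simp add: neg_part_def)

lemma split_tt_ff: "x \<in> carrier L \<Longrightarrow> (x \<sqinter> tt L) \<squnion> (x \<sqinter> ff L) = x"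
  using meet_join_distrib[of x "tt L" "ff L"] by simp

text \<open>By distributivity an element is the join of its two parts, so comparing the parts is
  enough.\<close>

lemma le_iff_parts:
  assumes "x \<in> carrier L" "y \<in> carrier L"
  shows "x \<sqsubseteq> y \<longleftrightarrow> x \<sqinter> tt L \<sqsubseteq> y \<sqinter> tt L \<and> x \<sqinter> ff L \<sqsubseteq> y \<sqinter> ff L"
proof
  assume "x \<sqsubseteq> y"
  then show "x \<sqinter> tt L \<sqsubseteq> y \<sqinter> tt L \<and> x \<sqinter> ff L \<sqsubseteq> y \<sqinter> ff L"
    using assms by (simp add: le_meet_iff meet_right) (meson assms ff_closed le_trans meet_closed meet_left tt_closed)
next
  assume "x \<sqinter> tt L \<sqsubseteq> y \<sqinter> tt L \<and> x \<sqinter> ff L \<sqsubseteq> y \<sqinter> ff L"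
  then have "(x \<sqinter> tt L) \<squnion> (x \<sqinter> ff L) \<sqsubseteq> y"
    using assms by (simp add: join_le_iff le_meet_iff)
  then show "x \<sqsubseteq> y" using assms by (simp add: split_tt_ff)
qed

lemma neg_meet_tt:
  assumes "b \<in> neg_part L" shows "b \<sqinter> tt L = \<bottom>"
proof -
  have "b \<sqinter> tt L \<sqsubseteq> tt L \<sqinter> ff L"
    using assms unfolding neg_part_def
    by (intro meet_le) (auto simp: meet_right intro: le_trans[OF meet_left])
  then show ?thesis
    using assms by (simp add: neg_part_def le_bottom_iff)
qed

lemma pos_meet_ff:
  assumes "a \<in> pos_part L" shows "a \<sqinter> ff L = \<bottom>"
proof -
  have "a \<sqinter> ff L \<sqsubseteq> tt L \<sqinter> ff L"
    using assms unfolding pos_part_def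
    by (intro meet_le) (auto simp: meet_right intro: le_trans[OF meet_left])
  then show ?thesis
    using assms by (simp add: pos_part_def le_bottom_iff)
qed

text \<open>Cross terms vanish because \<open>tt L \<sqinter> ff L\<close> is bottom. With
  \<open>split_tt_ff\<close> this makes \<open>L\<close> the product of its positive and negative
  parts.\<close>

lemma join_parts:
  assumes "a \<in> pos_part L" "b \<in> neg_part L"
  shows "(a \<squnion> b) \<sqinter> tt L = a" "(a \<squnion> b) \<sqinter> ff L = b"
  using assms pos_part_iff[of a] neg_part_iff[of b]
  by (simp_all add: join_meet_distrib_right neg_meet_tt pos_meet_ff)

lemma distributive_lattice_pos_lattice: "distributive_lattice (pos_lattice L)"
proof (rule distributive_latticeI[where j = "join L" and m = "meet L" and b = "\<bottom>" and t = "tt L"])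
  show "partial_order (pos_lattice L)"
    by unfold_locales (auto simp: pos_part_def intro: le_antisym le_trans)
  show "x \<sqinter> y \<in> carrier (pos_lattice L)"
    if "x \<in> carrier (pos_lattice L)" "y \<in> carrier (pos_lattice L)" for x y
    using that le_trans[OF meet_left, of x y "tt L"] by (simp add: pos_part_def)
qed (simp_all add: pos_part_def join_le_iff le_meet_iff meet_join_distrib)

text \<open>The operations of \<open>pos_lattice L\<close> are computed in its own order. They agree
  with those of \<open>L\<close> because joins and meets of elements below \<open>tt L\<close> stay
  below it.\<close>

lemma pos_lattice_ops:
  shows "\<lbrakk>x \<in> pos_part L; y \<in> pos_part L\<rbrakk> \<Longrightarrow> x \<squnion>\<^bsub>pos_lattice L\<^esub> y = x \<squnion> y"
    and "\<lbrakk>x \<in> pos_part L; y \<in> pos_part L\<rbrakk> \<Longrightarrow> x \<sqinter>\<^bsub>pos_lattice L\<^esub> y = x \<sqinter> y"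
    and "\<bottom>\<^bsub>pos_lattice L\<^esub> = \<bottom>" "\<top>\<^bsub>pos_lattice L\<^esub> = tt L"
proof -
  have P: "bounded_lattice (pos_lattice L)" "lattice (pos_lattice L)"
    using distributive_lattice_pos_lattice
    by (simp_all add: distributive_lattice_def bounded_lattice_def)
  show "x \<squnion>\<^bsub>pos_lattice L\<^esub> y = x \<squnion> y" if "x \<in> pos_part L" "y \<in> pos_part L"
    by (rule lattice.join_eqI[OF P(2)])
      (use that in \<open>simp_all add: pos_part_def join_left join_right join_le_iff\<close>)
  show "x \<sqinter>\<^bsub>pos_lattice L\<^esub> y = x \<sqinter> y" if "x \<in> pos_part L" "y \<in> pos_part L"
    by (rule lattice.meet_eqI[OF P(2)])
      (use that le_trans[OF meet_left, of x y "tt L"] in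
        \<open>simp_all add: pos_part_def meet_left meet_right le_meet_iff\<close>)
  show "\<bottom>\<^bsub>pos_lattice L\<^esub> = \<bottom>"
    by (rule bounded_lattice.bottom_eq[OF P(1), symmetric]) (simp_all add: pos_part_def)
  show "\<top>\<^bsub>pos_lattice L\<^esub> = tt L"
    by (rule bounded_lattice.top_eq[OF P(1), symmetric]) (simp_all add: pos_part_def)
qed

text \<open>Otherwise \<open>ff L\<close> would be top, against properness of the pair. This keeps
  the positive part nondegenerate, as the lattice category requires.\<close>

lemma tt_neq_bottom: "tt L \<noteq> \<bottom>"
proof
  assume "tt L = \<bottom>"
  moreover from this have "ff L = \<top>" using tt_join_ff by simp
  ultimately show False using tt_ff_proper by auto
qed

end

section \<open>Coordinates on d-Boolean algebras\<close>

text \<open>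
  The coordinates identify \<open>L\<close> with \<open>M \<times> M\<^sup>o\<^sup>p\<close>: \<open>p\<close> is the positive part, \<open>q\<close> the negative part
  read in \<open>M\<close> by reversing the order.
\<close>

locale d_coordinates = M: distributive_lattice M
  for L :: "('a, 'b) d_struct_scheme" and M :: "('c, 'd) gorder_scheme" (structure) +
  fixes p q :: "'a \<Rightarrow> 'c"
  assumes nontrivial: "\<bottom> \<noteq> \<top>"
    and eq_L: "eq L = (=)"
    and bij_coordinates: "bij_betw (\<lambda>x. (p x, q x)) (carrier L) (carrier M \<times> carrier M)"
    and le_L_iff: "\<lbrakk>x \<in> carrier L; y \<in> carrier L\<rbrakk> \<Longrightarrow> x \<sqsubseteq>\<^bsub>L\<^esub> y \<longleftrightarrow> p x \<sqsubseteq> p y \<and> q y \<sqsubseteq> q x"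
    and tt_coordinates: "tt L \<in> carrier L" "p (tt L) = \<top>" "q (tt L) = \<top>"
    and ff_coordinates: "ff L \<in> carrier L" "p (ff L) = \<bottom>" "q (ff L) = \<bottom>"
    and con_L: "con L = {x \<in> carrier L. p x \<sqsubseteq> q x}"
    and tot_L: "tot L = {x \<in> carrier L. q x \<sqsubseteq> p x}"
begin

definition point :: "'c \<Rightarrow> 'c \<Rightarrow> 'a" where
  "point a b = inv_into (carrier L) (\<lambda>x. (p x, q x)) (a, b)"

lemma coordinates_closed [simp]:
  assumes "x \<in> carrier L" shows "p x \<in> carrier M" "q x \<in> carrier M"
  using bij_betwE[OF bij_coordinates] assms by auto

lemma point [simp]:
  assumes "a \<in> carrier M" "b \<in> carrier M"
  shows "point a b \<in> carrier L" "p (point a b) = a" "q (point a b) = b"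
proof -
  have "(a, b) \<in> (\<lambda>x. (p x, q x)) ` carrier L"
    using assms bij_coordinates by (simp add: bij_betw_def)
  then show "point a b \<in> carrier L" "p (point a b) = a" "q (point a b) = b"
    unfolding point_def
    using inv_into_into[of "(a, b)" "\<lambda>x. (p x, q x)" "carrier L"]
      f_inv_into_f[of "(a, b)" "\<lambda>x. (p x, q x)" "carrier L"] by simp_all
qed

lemma coordinates_eqI:
  "\<lbrakk>x \<in> carrier L; y \<in> carrier L; p x = p y; q x = q y\<rbrakk> \<Longrightarrow> x = y"
  using bij_coordinates by (auto simp: bij_betw_def inj_on_def)

lemma partial_order_L: "partial_order L"
proof
  fix x y assume "x \<in> carrier L" "y \<in> carrier L" "x \<sqsubseteq>\<^bsub>L\<^esub> y" "y \<sqsubseteq>\<^bsub>L\<^esub> x"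
  then show "x .=\<^bsub>L\<^esub> y"
    by (simp add: eq_L le_L_iff) (meson M.le_antisym coordinates_closed coordinates_eqI)
next
  fix x y z assume "x \<sqsubseteq>\<^bsub>L\<^esub> y" "y \<sqsubseteq>\<^bsub>L\<^esub> z" "x \<in> carrier L" "y \<in> carrier L" "z \<in> carrier L"
  then show "x \<sqsubseteq>\<^bsub>L\<^esub> z"
    by (simp add: le_L_iff) (meson M.le_trans coordinates_closed)
qed (simp_all add: eq_L le_L_iff)

text \<open>The second coordinate carries the opposite order, so there joins and meets swap and
  distributivity becomes the dual law of \<open>M\<close>.\<close>

lemma distributive_lattice_L: "distributive_lattice L"
proof (rule distributive_latticeI[OF partial_order_L,
      where j = "\<lambda>x y. point (p x \<squnion> p y) (q x \<sqinter> q y)" and m = "\<lambda>x y. point (p x \<sqinter> p y) (q x \<squnion> q y)"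
        and b = "point \<bottom> \<top>" and t = "point \<top> \<bottom>"])
  fix x y z assume "x \<in> carrier L" "y \<in> carrier L" "z \<in> carrier L"
  then show "point (p x \<sqinter> p (point (p y \<squnion> p z) (q y \<sqinter> q z))) (q x \<squnion> q (point (p y \<squnion> p z) (q y \<sqinter> q z))) =
    point (p (point (p x \<sqinter> p y) (q x \<squnion> q y)) \<squnion> p (point (p x \<sqinter> p z) (q x \<squnion> q z)))
      (q (point (p x \<sqinter> p y) (q x \<squnion> q y)) \<sqinter> q (point (p x \<sqinter> p z) (q x \<squnion> q z)))"
    using M.meet_join_distrib[of "p x" "p y" "p z"] M.join_meet_distrib[of "q x" "q y" "q z"] by simp
qed (auto simp: le_L_iff M.join_le_iff M.le_meet_iff)

sublocale L: distributive_lattice L by (rule distributive_lattice_L)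

lemma join_coordinates [simp]:
  assumes "x \<in> carrier L" "y \<in> carrier L"
  shows "p (x \<squnion>\<^bsub>L\<^esub> y) = p x \<squnion> p y" "q (x \<squnion>\<^bsub>L\<^esub> y) = q x \<sqinter> q y"
proof -
  have "x \<squnion>\<^bsub>L\<^esub> y = point (p x \<squnion> p y) (q x \<sqinter> q y)"
    by (rule L.join_eqI)
      (use assms in \<open>simp_all add: le_L_iff M.join_left M.join_right M.join_le_iff
        M.meet_left M.meet_right M.le_meet_iff\<close>)
  then show "p (x \<squnion>\<^bsub>L\<^esub> y) = p x \<squnion> p y" "q (x \<squnion>\<^bsub>L\<^esub> y) = q x \<sqinter> q y"
    using assms by simp_all
qed

lemma meet_coordinates [simp]:
  assumes "x \<in> carrier L" "y \<in> carrier L"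
  shows "p (x \<sqinter>\<^bsub>L\<^esub> y) = p x \<sqinter> p y" "q (x \<sqinter>\<^bsub>L\<^esub> y) = q x \<squnion> q y"
proof -
  have "x \<sqinter>\<^bsub>L\<^esub> y = point (p x \<sqinter> p y) (q x \<squnion> q y)"
    by (rule L.meet_eqI)
      (use assms in \<open>simp_all add: le_L_iff M.join_left M.join_right M.join_le_iff
        M.meet_left M.meet_right M.le_meet_iff\<close>)
  then show "p (x \<sqinter>\<^bsub>L\<^esub> y) = p x \<sqinter> p y" "q (x \<sqinter>\<^bsub>L\<^esub> y) = q x \<squnion> q y"
    using assms by simp_all
qed

lemma bottom_coordinates [simp]: "p \<bottom>\<^bsub>L\<^esub> = \<bottom>" "q \<bottom>\<^bsub>L\<^esub> = \<top>"
proof -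
  have "\<bottom>\<^bsub>L\<^esub> = point \<bottom> \<top>"
    by (rule L.bottom_eq[symmetric]) (simp_all add: le_L_iff)
  then show "p \<bottom>\<^bsub>L\<^esub> = \<bottom>" "q \<bottom>\<^bsub>L\<^esub> = \<top>" by simp_all
qed

lemma top_coordinates [simp]: "p \<top>\<^bsub>L\<^esub> = \<top>" "q \<top>\<^bsub>L\<^esub> = \<bottom>"
proof -
  have "\<top>\<^bsub>L\<^esub> = point \<top> \<bottom>"
    by (rule L.top_eq[symmetric]) (simp_all add: le_L_iff)
  then show "p \<top>\<^bsub>L\<^esub> = \<top>" "q \<top>\<^bsub>L\<^esub> = \<bottom>" by simp_all
qed

lemmas coordinates_simps = tt_coordinates ff_coordinates

text \<open>The logic order reverses the negative part and \<open>q\<close> reverses it again, so in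
  coordinates it is the componentwise order of \<open>M \<times> M\<close>. The extra terms
  disappear by absorption, here in the second coordinate.\<close>

lemma logic_meet_coordinates:
  assumes "x \<in> carrier L" "y \<in> carrier L"
  shows "logic_meet L x y \<in> carrier L"
    and "p (logic_meet L x y) = p x \<sqinter> p y" "q (logic_meet L x y) = q x \<sqinter> q y"
proof -
  have "q x \<sqinter> q y \<sqinter> (q x \<squnion> q y) = q x \<sqinter> q y"
    using assms M.le_iff_join[of "q x \<sqinter> q y" "q x \<squnion> q y"]
      M.le_trans[OF M.meet_left M.join_left, of "q x" "q y" "q y"] by simp
  then show "logic_meet L x y \<in> carrier L"
    "p (logic_meet L x y) = p x \<sqinter> p y" "q (logic_meet L x y) = q x \<sqinter> q y"
    using assms by (simp_all add: logic_meet_def coordinates_simps)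
qed

text \<open>The same computation, with the absorption in the first coordinate.\<close>

lemma logic_join_coordinates:
  assumes "x \<in> carrier L" "y \<in> carrier L"
  shows "logic_join L x y \<in> carrier L"
    and "p (logic_join L x y) = p x \<squnion> p y" "q (logic_join L x y) = q x \<squnion> q y"
proof -
  have "p x \<squnion> p y \<squnion> p x \<sqinter> p y = p x \<squnion> p y"
    using assms M.le_iff_meet[of "p x \<sqinter> p y" "p x \<squnion> p y"]
      M.le_trans[OF M.meet_left M.join_left, of "p x" "p y" "p y"]
    by (simp add: join_comm[of M "p x \<squnion> p y"])
  then show "logic_join L x y \<in> carrier L"
    "p (logic_join L x y) = p x \<squnion> p y" "q (logic_join L x y) = q x \<squnion> q y"
    using assms by (simp_all add: logic_join_def coordinates_simps)
qed

text \<open>Lying below \<open>tt L\<close>, with both coordinates \<open>\<top>\<close>, leaves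
  \<open>p\<close> free and forces \<open>q\<close> up to \<open>\<top>\<close>, since
  \<open>q\<close> is compared in reverse.\<close>

lemma pos_part_L: "pos_part L = {x \<in> carrier L. q x = \<top>}"
  by (auto simp: pos_part_def le_L_iff coordinates_simps M.top_le_iff)

lemma neg_part_L: "neg_part L = {x \<in> carrier L. p x = \<bottom>}"
  by (auto simp: neg_part_def le_L_iff coordinates_simps M.le_bottom_iff)

text \<open>In coordinates \<open>con\<close> and \<open>tot\<close> are the order of
  \<open>M\<close> and its converse. Transitivity gives their closure in the information order,
  monotonicity of the operations of \<open>M\<close> their closure in the logic order.\<close>

lemma d_boolean_algebra_L: "d_boolean_algebra L"
proof
  have meet_mono: "a \<sqinter> b \<sqsubseteq> c \<sqinter> d" and join_mono: "a \<squnion> b \<sqsubseteq> c \<squnion> d"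
    if "a \<in> carrier M" "b \<in> carrier M" "c \<in> carrier M" "d \<in> carrier M" "a \<sqsubseteq> c" "b \<sqsubseteq> d" for a b c d
    using that M.le_trans[OF M.meet_left, of a b c] M.le_trans[OF M.meet_right, of a b d]
      M.le_trans[OF _ M.join_left, of a c d] M.le_trans[OF _ M.join_right, of b d c]
    by (simp_all add: M.le_meet_iff M.join_le_iff)
  \<comment> \<open>The coordinates are \<open>(\<top>, \<top>)\<close> for \<open>tt L\<close>,
    \<open>(\<top>, \<bottom>)\<close> for the top and \<open>(\<bottom>, \<top>)\<close> for the
    bottom of \<open>L\<close>.\<close>
  have neq: "tt L \<noteq> \<top>\<^bsub>L\<^esub>" "tt L \<noteq> \<bottom>\<^bsub>L\<^esub>"
    using nontrivial coordinates_simps top_coordinates bottom_coordinates by metis+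
  show "tt L \<squnion>\<^bsub>L\<^esub> ff L = \<top>\<^bsub>L\<^esub>" "tt L \<sqinter>\<^bsub>L\<^esub> ff L = \<bottom>\<^bsub>L\<^esub>"
    by (auto intro!: coordinates_eqI simp: coordinates_simps)
  show "{tt L, ff L} \<noteq> {\<top>\<^bsub>L\<^esub>, \<bottom>\<^bsub>L\<^esub>}"
    using neq by auto
  show "y \<in> con L" if "x \<in> con L" "y \<in> carrier L" "y \<sqsubseteq>\<^bsub>L\<^esub> x" for x y
    using that by (simp add: con_L le_L_iff) (meson M.le_trans coordinates_closed)
  show "y \<in> tot L" if "x \<in> tot L" "y \<in> carrier L" "x \<sqsubseteq>\<^bsub>L\<^esub> y" for x y
    using that by (simp add: tot_L le_L_iff) (meson M.le_trans coordinates_closed)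
  show "\<alpha> \<sqsubseteq>\<^bsub>L\<^esub> \<beta>" if "\<alpha> \<in> con L" "\<beta> \<in> tot L"
    "\<alpha> \<sqinter>\<^bsub>L\<^esub> tt L = \<beta> \<sqinter>\<^bsub>L\<^esub> tt L \<or> \<alpha> \<sqinter>\<^bsub>L\<^esub> ff L = \<beta> \<sqinter>\<^bsub>L\<^esub> ff L" for \<alpha> \<beta>
  proof -
    have *: "\<alpha> \<in> carrier L" "p \<alpha> \<sqsubseteq> q \<alpha>" "\<beta> \<in> carrier L" "q \<beta> \<sqsubseteq> p \<beta>"
      using that by (simp_all add: con_L tot_L)
    \<comment> \<open>Meeting with \<open>tt L\<close> keeps the first coordinate and meeting with
      \<open>ff L\<close> keeps the second. Once \<open>\<alpha>\<close> and \<open>\<beta>\<close>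
      share a coordinate, the other comparison follows by transitivity through it.\<close>
    have "p (\<alpha> \<sqinter>\<^bsub>L\<^esub> tt L) = p (\<beta> \<sqinter>\<^bsub>L\<^esub> tt L) \<or> q (\<alpha> \<sqinter>\<^bsub>L\<^esub> ff L) = q (\<beta> \<sqinter>\<^bsub>L\<^esub> ff L)"
      using that(3) by auto
    then have "p \<alpha> = p \<beta> \<or> q \<alpha> = q \<beta>"
      using * by (simp add: coordinates_simps)
    then show ?thesis
      using * M.le_trans[of "p \<alpha>" "q \<beta>" "p \<beta>"] M.le_trans[of "q \<beta>" "p \<alpha>" "q \<alpha>"]
      by (auto simp: le_L_iff)
  qed
  \<comment> \<open>The complement is chosen so that the join lands on the diagonal, here at
    \<open>(p a, p a)\<close>, where both \<open>con\<close> and \<open>tot\<close> hold.\<close>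
  show "\<exists>a' \<in> neg_part L. a \<squnion>\<^bsub>L\<^esub> a' \<in> con L \<inter> tot L" if "a \<in> pos_part L" for a
    using that by (intro bexI[of _ "point \<bottom> (p a)"]) (simp_all add: pos_part_L neg_part_L con_L tot_L)
  show "\<exists>b' \<in> pos_part L. b' \<squnion>\<^bsub>L\<^esub> b \<in> con L \<inter> tot L" if "b \<in> neg_part L" for b
    using that by (intro bexI[of _ "point (q b) \<top>"]) (simp_all add: pos_part_L neg_part_L con_L tot_L)
  show "logic_meet L x y \<in> con L" "logic_join L x y \<in> con L" if "x \<in> con L" "y \<in> con L" for x y
    using that by (simp_all add: con_L logic_meet_coordinates logic_join_coordinates meet_mono join_mono)
  show "logic_meet L x y \<in> tot L" "logic_join L x y \<in> tot L" if "x \<in> tot L" "y \<in> tot L" for x y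
    using that by (simp_all add: tot_L logic_meet_coordinates logic_join_coordinates meet_mono join_mono)
qed (auto simp: coordinates_simps con_L tot_L)

text \<open>On the positive part \<open>q\<close> is constantly \<open>\<top>\<close>, so
  \<open>p\<close> is an order isomorphism onto \<open>M\<close> with inverse
  \<open>point a \<top>\<close>.\<close>

lemma lattice_hom_fst_coordinate: "restrict p (pos_part L) \<in> lattice_hom (pos_lattice L) M"
  and lattice_hom_point_top: "(\<lambda>a \<in> carrier M. point a \<top>) \<in> lattice_hom M (pos_lattice L)"
proof -
  interpret d_boolean_algebra L by (rule d_boolean_algebra_L)
  have P: "bounded_lattice (pos_lattice L)" "bounded_lattice M"
    using distributive_lattice_pos_lattice M.distributive_lattice_axioms
    by (simp_all add: distributive_lattice_def)
  have "bij_betw p (carrier (pos_lattice L)) (carrier M)"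
    by (rule bij_betw_byWitness[where f' = "\<lambda>a. point a \<top>"])
      (auto simp: pos_part_L intro: coordinates_eqI)
  then show "restrict p (pos_part L) \<in> lattice_hom (pos_lattice L) M"
    using order_iso_lattice_hom[OF P] by (simp add: pos_part_L le_L_iff)
  have "bij_betw (\<lambda>a. point a \<top>) (carrier M) (carrier (pos_lattice L))"
    by (rule bij_betw_byWitness[where f' = p])
      (auto simp: pos_part_L intro: coordinates_eqI)
  then show "(\<lambda>a \<in> carrier M. point a \<top>) \<in> lattice_hom M (pos_lattice L)"
    using order_iso_lattice_hom[OF P(2,1)] by (simp add: pos_part_L le_L_iff)
qed

end

text \<open>Apply \<open>g\<close> in both coordinates. It preserves joins and meets, so their swap
  in the second coordinate is harmless, and its monotonicity preserves \<open>con\<close> and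
  \<open>tot\<close>.\<close>

lemma d_lattice_hom_coordinates:
  assumes "d_coordinates A M p q" "d_coordinates B N p' q'" and g: "g \<in> lattice_hom M N"
  shows "\<exists>f \<in> d_lattice_hom A B. \<forall>x \<in> carrier A. p' (f x) = g (p x) \<and> q' (f x) = g (q x)"
proof -
  interpret A: d_coordinates A M p q by fact
  interpret B: d_coordinates B N p' q' by fact
  note [simp] = lattice_homD(4-8)[OF g]
  define f where "f = (\<lambda>x \<in> carrier A. B.point (g (p x)) (g (q x)))"
  have f [simp]: "f x \<in> carrier B" "p' (f x) = g (p x)" "q' (f x) = g (q x)" if "x \<in> carrier A" for x
    using that by (simp_all add: f_def)
  have "f \<in> carrier A \<rightarrow>\<^sub>E carrier B"
    by (simp add: PiE_iff) (simp add: f_def)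
  then have "f \<in> lattice_hom A B"
    unfolding lattice_hom_def join_pres_def meet_pres_def
    using A.L.lattice_axioms B.L.lattice_axioms
    by (auto intro!: B.coordinates_eqI)
  moreover have "f (tt A) = tt B" "f (ff A) = ff B"
    by (auto intro!: B.coordinates_eqI simp: A.coordinates_simps B.coordinates_simps)
  ultimately have "f \<in> d_lattice_hom A B"
    using lattice_homD(9)[OF g]
    by (auto simp: d_lattice_hom_def A.con_L B.con_L A.tot_L B.tot_L)
  then show ?thesis by (rule bexI[rotated]) simp
qed

section \<open>The complement from the negative to the positive part\<close>

text \<open>This direction supplies the second coordinate inside the positive part. In a d-Boolean
  algebra the choice is unique for negative \<open>b\<close>, by
  \<open>dagger_unique\<close>.\<close>

definition dagger :: "('a, 'b) d_struct_scheme \<Rightarrow> 'a \<Rightarrow> 'a" where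
  "dagger L b = (SOME a. a \<in> pos_part L \<and> a \<squnion>\<^bsub>L\<^esub> b \<in> con L \<inter> tot L)"

context d_boolean_algebra
begin

lemma dagger:
  assumes "b \<in> neg_part L"
  shows "dagger L b \<in> pos_part L" "dagger L b \<squnion> b \<in> con L" "dagger L b \<squnion> b \<in> tot L"
  using someI_ex[of "\<lambda>a. a \<in> pos_part L \<and> a \<squnion> b \<in> con L \<inter> tot L"] neg_complement[OF assms]
  unfolding dagger_def by blast+

text \<open>\<open>a \<squnion> b\<close> and the total element
  \<open>dagger L b \<squnion> b\<close> share the negative part \<open>b\<close>, so
  \<open>con_tot\<close> compares them; the converse holds because \<open>con\<close> is a lower
  set.\<close>

lemma con_iff_le_dagger:
  assumes "a \<in> pos_part L" "b \<in> neg_part L"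
  shows "a \<squnion> b \<in> con L \<longleftrightarrow> a \<sqsubseteq> dagger L b"
proof
  note [simp] = pos_part_closed neg_part_closed
  note d = dagger[OF assms(2)]
  { assume "a \<squnion> b \<in> con L"
    then have "a \<squnion> b \<sqsubseteq> dagger L b \<squnion> b"
      by (rule con_tot) (use d assms in \<open>simp_all add: join_parts\<close>)
    then show "a \<sqsubseteq> dagger L b"
      using assms d le_iff_parts[of "a \<squnion> b" "dagger L b \<squnion> b"] by (simp add: join_parts) }
  assume "a \<sqsubseteq> dagger L b"
  then have "a \<squnion> b \<sqsubseteq> dagger L b \<squnion> b"
    using assms d le_iff_parts[of "a \<squnion> b" "dagger L b \<squnion> b"] by (simp add: join_parts)
  then show "a \<squnion> b \<in> con L"
    using assms by (intro con_lower[OF d(2)]) simp_all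
qed

text \<open>Dually, \<open>dagger L b \<squnion> b\<close> now serves as the element of
  \<open>con\<close> in \<open>con_tot\<close>, and the converse uses that \<open>tot\<close> is an
  upper set.\<close>

lemma tot_iff_dagger_le:
  assumes "a \<in> pos_part L" "b \<in> neg_part L"
  shows "a \<squnion> b \<in> tot L \<longleftrightarrow> dagger L b \<sqsubseteq> a"
proof
  note [simp] = pos_part_closed neg_part_closed
  note d = dagger[OF assms(2)]
  { assume "a \<squnion> b \<in> tot L"
    then have "dagger L b \<squnion> b \<sqsubseteq> a \<squnion> b"
      by (rule con_tot[OF d(2)]) (use d assms in \<open>simp_all add: join_parts\<close>)
    then show "dagger L b \<sqsubseteq> a"
      using assms d le_iff_parts[of "dagger L b \<squnion> b" "a \<squnion> b"] by (simp add: join_parts) }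
  assume "dagger L b \<sqsubseteq> a"
  then have "dagger L b \<squnion> b \<sqsubseteq> a \<squnion> b"
    using assms d le_iff_parts[of "dagger L b \<squnion> b" "a \<squnion> b"] by (simp add: join_parts)
  then show "a \<squnion> b \<in> tot L"
    using assms by (intro tot_upper[OF d(3)]) simp_all
qed

lemma dagger_unique:
  assumes "a \<in> pos_part L" "b \<in> neg_part L" "a \<squnion> b \<in> con L" "a \<squnion> b \<in> tot L"
  shows "dagger L b = a"
  using assms dagger(1)[OF assms(2)] con_iff_le_dagger[of a b] tot_iff_dagger_le[of a b]
  by (intro le_antisym) (simp_all add: pos_part_closed)

text \<open>The pivot is \<open>dagger L c \<squnion> b\<close>: it lies in \<open>con\<close> iff
  \<open>dagger L c \<sqsubseteq> dagger L b\<close>, and it shares its positive part with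
  \<open>dagger L c \<squnion> c\<close>, which lies in both \<open>con\<close> and
  \<open>tot\<close>.\<close>

lemma dagger_le_iff:
  assumes "b \<in> neg_part L" "c \<in> neg_part L"
  shows "dagger L c \<sqsubseteq> dagger L b \<longleftrightarrow> b \<sqsubseteq> c"
proof
  note [simp] = pos_part_closed neg_part_closed
  note d = dagger[OF assms(2)]
  { assume "dagger L c \<sqsubseteq> dagger L b"
    then have "dagger L c \<squnion> b \<in> con L"
      using assms d by (simp add: con_iff_le_dagger)
    then have "dagger L c \<squnion> b \<sqsubseteq> dagger L c \<squnion> c"
      by (rule con_tot) (use d assms in \<open>simp_all add: join_parts\<close>)
    then show "b \<sqsubseteq> c"
      using assms d le_iff_parts[of "dagger L c \<squnion> b" "dagger L c \<squnion> c"] by (simp add: join_parts) }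
  assume "b \<sqsubseteq> c"
  then have "dagger L c \<squnion> b \<sqsubseteq> dagger L c \<squnion> c"
    using assms d le_iff_parts[of "dagger L c \<squnion> b" "dagger L c \<squnion> c"] by (simp add: join_parts)
  then have "dagger L c \<squnion> b \<in> con L"
    using assms d by (intro con_lower[OF d(2)]) simp_all
  then show "dagger L c \<sqsubseteq> dagger L b"
    using assms d by (simp add: con_iff_le_dagger)
qed

text \<open>Every d-Boolean algebra is thus the product of its positive part with the opposite of
  that part, which reduces statements about homomorphisms to \<open>pos_lattice L\<close>.\<close>

lemma d_coordinates_pos_lattice:
  "d_coordinates L (pos_lattice L) (\<lambda>x. x \<sqinter> tt L) (\<lambda>x. dagger L (x \<sqinter> ff L))"
proof (intro d_coordinates.intro d_coordinates_axioms.intro distributive_lattice_pos_lattice)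
  have tt_pos: "tt L \<in> pos_part L" and ff_neg: "ff L \<in> neg_part L"
    and bot_pos: "\<bottom> \<in> pos_part L" and bot_neg: "\<bottom> \<in> neg_part L"
    by (simp_all add: pos_part_def neg_part_def)
  have "tt L \<sqinter> tt L = tt L" "ff L \<sqinter> ff L = ff L"
    using tt_pos ff_neg by (simp_all add: pos_part_iff neg_part_iff)
  \<comment> \<open>By uniqueness, since \<open>tt L \<squnion> \<bottom>\<close> and
    \<open>\<bottom> \<squnion> ff L\<close> are \<open>tt L\<close> and \<open>ff L\<close>, both
    in \<open>con\<close> and \<open>tot\<close>.\<close>
  moreover have "dagger L \<bottom> = tt L" "dagger L (ff L) = \<bottom>"
    by (intro dagger_unique tt_pos ff_neg bot_pos bot_neg; simp add: tt_con tt_tot ff_con ff_tot)+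
  ultimately show "tt L \<sqinter> tt L = \<top>\<^bsub>pos_lattice L\<^esub>" "dagger L (tt L \<sqinter> ff L) = \<top>\<^bsub>pos_lattice L\<^esub>"
    "ff L \<sqinter> tt L = \<bottom>\<^bsub>pos_lattice L\<^esub>" "dagger L (ff L \<sqinter> ff L) = \<bottom>\<^bsub>pos_lattice L\<^esub>"
    by (simp_all add: pos_lattice_ops)
  show "\<bottom>\<^bsub>pos_lattice L\<^esub> \<noteq> \<top>\<^bsub>pos_lattice L\<^esub>"
    using tt_neq_bottom by (simp add: pos_lattice_ops)
  show le: "x \<sqsubseteq> y \<longleftrightarrow> x \<sqinter> tt L \<sqsubseteq>\<^bsub>pos_lattice L\<^esub> y \<sqinter> tt L \<and>
      dagger L (y \<sqinter> ff L) \<sqsubseteq>\<^bsub>pos_lattice L\<^esub> dagger L (x \<sqinter> ff L)"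
    if "x \<in> carrier L" "y \<in> carrier L" for x y
    using that le_iff_parts[of x y] by (simp add: dagger_le_iff)
  show "con L = {x \<in> carrier L. x \<sqinter> tt L \<sqsubseteq>\<^bsub>pos_lattice L\<^esub> dagger L (x \<sqinter> ff L)}"
    using con_subset by (auto simp: con_iff_le_dagger[symmetric] split_tt_ff)
  show "tot L = {x \<in> carrier L. dagger L (x \<sqinter> ff L) \<sqsubseteq>\<^bsub>pos_lattice L\<^esub> x \<sqinter> tt L}"
    using tot_subset by (auto simp: tot_iff_dagger_le[symmetric] split_tt_ff)
  note [simp] = pos_part_closed neg_part_closed
  show "bij_betw (\<lambda>x. (x \<sqinter> tt L, dagger L (x \<sqinter> ff L))) (carrier L)
      (carrier (pos_lattice L) \<times> carrier (pos_lattice L))"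
    unfolding bij_betw_def
  proof (intro conjI inj_onI equalityI subsetI)
    fix x y assume "x \<in> carrier L" "y \<in> carrier L"
      "(x \<sqinter> tt L, dagger L (x \<sqinter> ff L)) = (y \<sqinter> tt L, dagger L (y \<sqinter> ff L))"
    then show "x = y"
      using le[of x y] le[of y x] by (intro le_antisym) (simp_all add: dagger(1))
  next
    fix z assume "z \<in> carrier (pos_lattice L) \<times> carrier (pos_lattice L)"
    then obtain a c where z: "z = (a, c)" and a: "a \<in> pos_part L" and c: "c \<in> pos_part L"
      by auto
    \<comment> \<open>Surjectivity of \<open>dagger\<close> comes from
      \<open>pos_complement\<close>: a complement \<open>b\<close> of \<open>c\<close> satisfies
      \<open>dagger L b = c\<close>, so \<open>a \<squnion> b\<close> has coordinates
      \<open>(a, c)\<close>.\<close>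
    obtain b where b: "b \<in> neg_part L" "c \<squnion> b \<in> con L \<inter> tot L"
      using pos_complement[OF c] by blast
    then have "dagger L b = c"
      using c by (intro dagger_unique) auto
    then show "z \<in> (\<lambda>x. (x \<sqinter> tt L, dagger L (x \<sqinter> ff L))) ` carrier L"
      using z a b by (intro image_eqI[of _ _ "a \<squnion> b"]) (simp_all add: join_parts)
  qed (auto simp: dagger(1))
  show "eq L = (=)" by (rule eq_is_equal)
qed simp_all

end

section \<open>The positive part functor\<close>

text \<open>Preservation of \<open>tt\<close> keeps positive elements positive and also gives
  preservation of the top of the positive part.\<close>

lemma lattice_hom_pos_part:
  assumes "f \<in> d_lattice_hom A B" "d_lattice A" "d_lattice B"
  shows "restrict f (pos_part A) \<in> lattice_hom (pos_lattice A) (pos_lattice B)"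
proof -
  interpret A: d_lattice A by fact
  interpret B: d_lattice B by fact
  have f: "f \<in> lattice_hom A B" and tt: "f (tt A) = tt B"
    using assms(1) by (auto simp: d_lattice_hom_def)
  note [simp] = lattice_homD(4-8)[OF f]
  have pos: "f a \<in> pos_part B" if "a \<in> pos_part A" for a
    using that lattice_homD(9)[OF f, of a "tt A"] by (simp add: pos_part_def tt)
  interpret PA: distributive_lattice "pos_lattice A" by (rule A.distributive_lattice_pos_lattice)
  interpret PB: distributive_lattice "pos_lattice B" by (rule B.distributive_lattice_pos_lattice)
  have closed: "x \<squnion>\<^bsub>A\<^esub> y \<in> pos_part A" "x \<sqinter>\<^bsub>A\<^esub> y \<in> pos_part A"
    if "x \<in> pos_part A" "y \<in> pos_part A" for x y
    using that PA.join_closed[of x y] PA.meet_closed[of x y] by (simp_all add: A.pos_lattice_ops)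
  have bounds: "\<bottom>\<^bsub>A\<^esub> \<in> pos_part A" "tt A \<in> pos_part A"
    by (simp_all add: pos_part_def)
  show ?thesis
    using PA.lattice_axioms PB.lattice_axioms pos closed bounds
    by (auto simp: lattice_hom_def join_pres_def meet_pres_def A.pos_lattice_ops B.pos_lattice_ops
        A.pos_part_closed tt)
qed

text \<open>The image of \<open>dagger A b \<squnion> b\<close> is again in \<open>con\<close> and
  \<open>tot\<close>, so uniqueness of the complement of \<open>f b\<close> applies.\<close>

lemma d_lattice_hom_dagger:
  assumes "f \<in> d_lattice_hom A B" "d_boolean_algebra A" "d_boolean_algebra B" "b \<in> neg_part A"
  shows "f (dagger A b) = dagger B (f b)"
proof -
  interpret A: d_boolean_algebra A by fact
  interpret B: d_boolean_algebra B by fact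
  have f: "f \<in> lattice_hom A B" and tt: "f (tt A) = tt B" "f (ff A) = ff B"
    and ct: "f ` con A \<subseteq> con B" "f ` tot A \<subseteq> tot B"
    using assms(1) by (auto simp: d_lattice_hom_def)
  note d = A.dagger[OF assms(4)]
  have "f (dagger A b) \<in> pos_part B" "f b \<in> neg_part B"
    using d assms(4) lattice_homD(9)[OF f, of "dagger A b" "tt A"] lattice_homD(9)[OF f, of b "ff A"]
    by (auto simp: pos_part_def neg_part_def tt lattice_homD(4)[OF f])
  moreover have "f (dagger A b \<squnion>\<^bsub>A\<^esub> b) = f (dagger A b) \<squnion>\<^bsub>B\<^esub> f b"
    using d assms(4) by (simp add: lattice_homD(5)[OF f] A.pos_part_closed A.neg_part_closed)
  ultimately show ?thesis
    using d ct by (intro B.dagger_unique[symmetric]) (auto simp: image_subset_iff)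
qed

text \<open>Faithfulness: both coordinates of \<open>h x\<close> are values of \<open>h\<close> at
  positive elements, the second one because \<open>h\<close> commutes with
  \<open>dagger\<close>.\<close>

lemma d_lattice_hom_eqI:
  assumes f: "f \<in> d_lattice_hom A B" and g: "g \<in> d_lattice_hom A B"
    and AB: "d_boolean_algebra A" "d_boolean_algebra B"
    and eq: "\<And>a. a \<in> pos_part A \<Longrightarrow> f a = g a"
  shows "f = g"
proof -
  interpret A: d_boolean_algebra A by fact
  interpret B: d_boolean_algebra B by fact
  have coords: "h x \<sqinter>\<^bsub>B\<^esub> tt B = h (x \<sqinter>\<^bsub>A\<^esub> tt A)"
    "dagger B (h x \<sqinter>\<^bsub>B\<^esub> ff B) = h (dagger A (x \<sqinter>\<^bsub>A\<^esub> ff A))"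
    "h x \<in> carrier B" "h \<in> extensional (carrier A)"
    if h: "h \<in> d_lattice_hom A B" and x: "x \<in> carrier A" for h x
  proof -
    have l: "h \<in> lattice_hom A B" and "h (tt A) = tt B" "h (ff A) = ff B"
      using h by (auto simp: d_lattice_hom_def)
    then show "h x \<sqinter>\<^bsub>B\<^esub> tt B = h (x \<sqinter>\<^bsub>A\<^esub> tt A)" "h x \<in> carrier B" "h \<in> extensional (carrier A)"
      "dagger B (h x \<sqinter>\<^bsub>B\<^esub> ff B) = h (dagger A (x \<sqinter>\<^bsub>A\<^esub> ff A))"
      using x lattice_homD(1)[OF l]
      by (simp_all add: lattice_homD(4,6)[OF l] d_lattice_hom_dagger[OF h AB] PiE_iff)
  qed
  have "f x = g x" if "x \<in> carrier A" for x
    by (rule d_coordinates.coordinates_eqI[OF B.d_coordinates_pos_lattice])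
      (use that coords(1-3)[OF f that] coords(1-3)[OF g that] in \<open>simp_all add: eq A.dagger(1)\<close>)
  then show ?thesis
    \<comment> \<open>\<open>coords\<close> is stated for a point of the carrier; bottom serves as
      an arbitrary one.\<close>
    by (rule extensionalityI[OF coords(4)[OF f A.bottom_closed] coords(4)[OF g A.bottom_closed]])
qed

text \<open>Fullness: act by \<open>g\<close> on both coordinates. A positive element is its own
  first coordinate, so the result restricts to \<open>g\<close>.\<close>

lemma d_lattice_hom_extension:
  assumes AB: "d_boolean_algebra A" "d_boolean_algebra B"
    and g: "g \<in> lattice_hom (pos_lattice A) (pos_lattice B)"
  shows "\<exists>f \<in> d_lattice_hom A B. restrict f (pos_part A) = g"
proof -
  interpret A: d_boolean_algebra A by fact
  interpret B: d_boolean_algebra B by fact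
  obtain f where f: "f \<in> d_lattice_hom A B"
    and fx: "\<And>x. x \<in> carrier A \<Longrightarrow> f x \<sqinter>\<^bsub>B\<^esub> tt B = g (x \<sqinter>\<^bsub>A\<^esub> tt A)"
    using d_lattice_hom_coordinates[OF A.d_coordinates_pos_lattice B.d_coordinates_pos_lattice g]
    by blast
  have "f a = g a" if a: "a \<in> pos_part A" for a
  proof -
    have "f a \<in> pos_part B"
      using lattice_homD(4)[OF lattice_hom_pos_part[OF f], of a] a A.d_lattice_axioms B.d_lattice_axioms
      by simp
    then show ?thesis
      using fx[of a] a by (simp add: A.pos_part_iff B.pos_part_iff)
  qed
  moreover have "g \<in> extensional (pos_part A)"
    using lattice_homD(1)[OF g] by (simp add: PiE_iff)
  ultimately have "restrict f (pos_part A) = g"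
    by (intro extensionalityI[of _ "pos_part A"]) simp_all
  with f show ?thesis by blast
qed

section \<open>Essential surjectivity\<close>

lemma ex_d_coordinates:
  fixes M :: "('a, 'b) gorder_scheme"
  assumes "infinite (UNIV :: 'a set)" "distributive_lattice M" "\<bottom>\<^bsub>M\<^esub> \<noteq> \<top>\<^bsub>M\<^esub>"
  shows "\<exists>(L :: 'a d_struct) p q. d_coordinates L M p q"
proof -
  interpret distributive_lattice M by fact
  \<comment> \<open>An infinite set is equipotent with its square, so pairs can be coded by single
    elements and the product structure transported along \<open>c\<close> onto the type
    \<open>'a\<close>.\<close>
  obtain c :: "'a \<Rightarrow> 'a \<times> 'a" where c: "bij c"
    using card_of_Times_same_infinite[OF assms(1)] card_of_ordIso ordIso_symmetric
    by (metis UNIV_Times_UNIV)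
  let ?p = "\<lambda>x. fst (c x)" and ?q = "\<lambda>x. snd (c x)"
  define L :: "'a d_struct" where "L = \<lparr>carrier = {x. c x \<in> carrier M \<times> carrier M}, eq = (=),
    le = (\<lambda>x y. ?p x \<sqsubseteq>\<^bsub>M\<^esub> ?p y \<and> ?q y \<sqsubseteq>\<^bsub>M\<^esub> ?q x),
    tt = inv c (\<top>\<^bsub>M\<^esub>, \<top>\<^bsub>M\<^esub>), ff = inv c (\<bottom>\<^bsub>M\<^esub>, \<bottom>\<^bsub>M\<^esub>),
    con = {x. c x \<in> carrier M \<times> carrier M \<and> ?p x \<sqsubseteq>\<^bsub>M\<^esub> ?q x},
    tot = {x. c x \<in> carrier M \<times> carrier M \<and> ?q x \<sqsubseteq>\<^bsub>M\<^esub> ?p x}\<rparr>"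
  have [simp]: "inv c (c x) = x" "c (inv c z) = z" for x z
    using c by (simp_all add: bij_is_inj bij_is_surj surj_f_inv_f)
  have "bij_betw c (carrier L) (carrier M \<times> carrier M)"
    by (rule bij_betw_byWitness[where f' = "inv c"]) (auto simp: L_def)
  then have "d_coordinates L M ?p ?q"
    by unfold_locales
      (use assms(3) in \<open>auto simp: L_def\<close>)
  then show ?thesis by blast
qed

lemma lattice_isomorphism_pos_lattice:
  assumes "d_coordinates L M p q"
  shows "\<exists>f \<in> lattice_hom (pos_lattice L) M. \<exists>g \<in> lattice_hom M (pos_lattice L).
    compose (pos_part L) g f = (\<lambda>x \<in> pos_part L. x) \<and> compose (carrier M) f g = (\<lambda>x \<in> carrier M. x)"
proof -
  interpret d_coordinates L M p q by fact
  have "compose (pos_part L) (\<lambda>a \<in> carrier M. point a \<top>\<^bsub>M\<^esub>) (restrict p (pos_part L))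
      = (\<lambda>x \<in> pos_part L. x)"
    by (rule extensionalityI[of _ "pos_part L"])
      (auto simp: compose_eq pos_part_L intro: coordinates_eqI)
  moreover have "compose (carrier M) (restrict p (pos_part L)) (\<lambda>a \<in> carrier M. point a \<top>\<^bsub>M\<^esub>)
      = (\<lambda>x \<in> carrier M. x)"
    by (rule extensionalityI[of _ "carrier M"]) (auto simp: compose_eq pos_part_L)
  ultimately show ?thesis
    using lattice_hom_fst_coordinate lattice_hom_point_top by blast
qed

section \<open>The two categories and the functor between them\<close>

lemma distributive_lattice_category_simps [simp]:
  "Obj distributive_lattice_category = {L. distributive_lattice L \<and> \<bottom>\<^bsub>L\<^esub> \<noteq> \<top>\<^bsub>L\<^esub>}"
  "Hom distributive_lattice_category = lattice_hom"
  "Ident distributive_lattice_category A = (\<lambda>x \<in> carrier A. x)"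
  "Comp distributive_lattice_category A B C g f = compose (carrier A) g f"
  by (simp_all add: distributive_lattice_category_def concrete_category_def)

lemma d_boolean_algebra_category_simps [simp]:
  "Obj d_boolean_algebra_category = {L. d_boolean_algebra L}"
  "Hom d_boolean_algebra_category = d_lattice_hom"
  "Ident d_boolean_algebra_category A = (\<lambda>x \<in> carrier A. x)"
  "Comp d_boolean_algebra_category A B C g f = compose (carrier A) g f"
  by (simp_all add: d_boolean_algebra_category_def concrete_category_def)

lemma category_distributive_lattice_category:
  "category (distributive_lattice_category :: ('a gorder, 'a \<Rightarrow> 'a) cat)"
  unfolding distributive_lattice_category_def
proof (rule category_concrete_category)
  fix A :: "'a gorder" assume "A \<in> {L. distributive_lattice L \<and> \<bottom>\<^bsub>L\<^esub> \<noteq> \<top>\<^bsub>L\<^esub>}"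
  then interpret distributive_lattice A by simp
  show "(\<lambda>x \<in> carrier A. x) \<in> lattice_hom A A"
    by (rule lattice_hom_id)
  fix B C f g assume "f \<in> lattice_hom A B" "g \<in> lattice_hom B C"
  then show "compose (carrier A) g f \<in> lattice_hom A C"
    by (rule lattice_hom_compose)
qed (auto simp: lattice_hom_def)

lemma category_d_boolean_algebra_category:
  "category (d_boolean_algebra_category :: ('a d_struct, 'a \<Rightarrow> 'a) cat)"
  unfolding d_boolean_algebra_category_def
proof (rule category_concrete_category)
  fix A :: "'a d_struct" assume "A \<in> {L. d_boolean_algebra L}"
  then interpret d_boolean_algebra A by simp
  show "(\<lambda>x \<in> carrier A. x) \<in> d_lattice_hom A A"
    \<comment> \<open>\<open>con\<close> and \<open>tot\<close> lie in the carrier, where the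
      restricted identity takes its intended values; the same holds for \<open>compose\<close>
      below.\<close>
    using lattice_hom_id con_subset tot_subset
    by (auto simp: d_lattice_hom_def)
  fix B C f g assume "f \<in> d_lattice_hom A B" "g \<in> d_lattice_hom B C"
  then show "compose (carrier A) g f \<in> d_lattice_hom A C"
    using lattice_hom_compose[of f B g C] con_subset tot_subset
    by (auto simp: d_lattice_hom_def compose_eq image_subset_iff subset_iff)
qed (auto simp: d_lattice_hom_def lattice_hom_def)

definition pos_functor :: "('a d_struct, 'a \<Rightarrow> 'a, 'a gorder, 'a \<Rightarrow> 'a) ftor" where
  "pos_functor = \<lparr>OMap = pos_lattice, AMap = (\<lambda>A B f. restrict f (pos_part A))\<rparr>"

lemma pos_functor_simps [simp]:
  "OMap pos_functor = pos_lattice" "AMap pos_functor A B f = restrict f (pos_part A)"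
  by (simp_all add: pos_functor_def)

lemma cat_functor_pos_functor:
  "cat_functor d_boolean_algebra_category distributive_lattice_category pos_functor"
proof (intro cat_functor.intro category_d_boolean_algebra_category
    category_distributive_lattice_category cat_functor_axioms.intro)
  fix A :: "'a d_struct" assume A: "A \<in> Obj d_boolean_algebra_category"
  then interpret A: d_boolean_algebra A by simp
  show "OMap pos_functor A \<in> Obj distributive_lattice_category"
    using A.distributive_lattice_pos_lattice A.tt_neq_bottom by (simp add: A.pos_lattice_ops)
  show "AMap pos_functor A A (Ident d_boolean_algebra_category A) =
      Ident distributive_lattice_category (OMap pos_functor A)"
    by (auto simp: A.pos_part_closed restrict_def)
  fix B :: "'a d_struct" and f
  assume "B \<in> Obj d_boolean_algebra_category" and f: "f \<in> Hom d_boolean_algebra_category A B"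
  then interpret B: d_boolean_algebra B by simp
  show fl: "AMap pos_functor A B f \<in> Hom distributive_lattice_category (OMap pos_functor A) (OMap pos_functor B)"
    using f by (simp add: lattice_hom_pos_part A.d_lattice_axioms B.d_lattice_axioms)
  fix C :: "'a d_struct" and g
  show "AMap pos_functor A C (Comp d_boolean_algebra_category A B C g f) =
      Comp distributive_lattice_category (OMap pos_functor A) (OMap pos_functor B) (OMap pos_functor C)
        (AMap pos_functor B C g) (AMap pos_functor A B f)"
  proof (rule extensionalityI[of _ "pos_part A"])
    fix x assume "x \<in> pos_part A"
    then show "AMap pos_functor A C (Comp d_boolean_algebra_category A B C g f) x =
      Comp distributive_lattice_category (OMap pos_functor A) (OMap pos_functor B) (OMap pos_functor C)
        (AMap pos_functor B C g) (AMap pos_functor A B f) x"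
      \<comment> \<open>\<open>f x\<close> is positive again, so the outer restriction of
        \<open>g\<close> does not affect its value there.\<close>
      using lattice_homD(4)[of "restrict f (pos_part A)" "pos_lattice A" "pos_lattice B" x] fl
      by (simp add: compose_eq A.pos_part_closed)
  qed simp_all
qed

theorem proposition4p17:
  assumes "infinite (UNIV :: 'a set)"
  shows "equivalent_categories
           (d_boolean_algebra_category :: ('a d_struct, 'a \<Rightarrow> 'a) cat)
           (distributive_lattice_category :: ('a gorder, 'a \<Rightarrow> 'a) cat)"
proof (rule equivalent_categories_if_fully_faithful[OF cat_functor_pos_functor])
  fix A B :: "'a d_struct"
  assume "A \<in> Obj d_boolean_algebra_category" "B \<in> Obj d_boolean_algebra_category"
  then have AB: "d_boolean_algebra A" "d_boolean_algebra B" by simp_all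
  show "\<exists>f \<in> Hom d_boolean_algebra_category A B. AMap pos_functor A B f = g"
    if "g \<in> Hom distributive_lattice_category (OMap pos_functor A) (OMap pos_functor B)" for g
    using d_lattice_hom_extension[OF AB] that by simp
  show "f = g" if "f \<in> Hom d_boolean_algebra_category A B" "g \<in> Hom d_boolean_algebra_category A B"
    "AMap pos_functor A B f = AMap pos_functor A B g" for f g
  proof (rule d_lattice_hom_eqI[OF _ _ AB])
    show "f a = g a" if "a \<in> pos_part A" for a
      using fun_cong[OF \<open>AMap pos_functor A B f = AMap pos_functor A B g\<close>, of a] that by simp
  qed (use that in simp_all)
next
  fix M :: "'a gorder" assume M: "M \<in> Obj distributive_lattice_category"
  then obtain L :: "'a d_struct" and p q where L: "d_coordinates L M p q"
    using ex_d_coordinates[OF assms, of M] by auto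
  have "cat_iso distributive_lattice_category (OMap pos_functor L) M \<noteq> {}"
    using lattice_isomorphism_pos_lattice[OF L] unfolding cat_iso_def by auto
  then show "\<exists>L \<in> Obj d_boolean_algebra_category.
      cat_iso distributive_lattice_category (OMap pos_functor L) M \<noteq> {}"
    using d_coordinates.d_boolean_algebra_L[OF L] by auto
qed

end
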